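(* Let $u\in\mathcal X$ be the solution of $$a(u,v)+b(u;u,v)=\langle f,v\rangle_\Omega\qquad\forall\, v\in\mathcal X,$$ and let $u_h\in V_{\mathcal P}$ be the solution of $$a(u_h^+,v_h)+b(u_h^+;u_h^+,v_h)+s(u_h^-,v_h)=\langle f,v_h\rangle_\Omega\qquad\forall\, v_h\in V_{\mathcal P}.$$ Then there is a constant $C>0$, independent of the partition $\mathcal P$ (in particular of $h$), such that $$\|u-u_h^+\|_a^2+\|u-u_h^+\|_{(u,p)}^2\le C\inf_{v_h\in V_{\mathcal P}^+}\Big(\|u-v_h\|_a^2+\|u-v_h\|_{(u,p)}^2\Big).$$
   Context: Setting. $\Omega\subset\mathbb R^d$, $d\in\{1,2,3\}$, is an open bounded domain with polyhedral Lipschitz boundary; $p\in[2,\infty)$; $f\in H^{-1}(\Omega)$, with $\langle\cdot,\cdot\rangle_\Omega$ the duality pairing extending the $L^2$ inner product $(\cdot,\cdot)_\Omega$. The tensor $\mathcal D\in L^\infty(\Omega)^{d\times d}$ is symmetric and there is $d_0>0$ with $y^T\mathcal D(x)y\ge d_0|y|^2$ for all $y\in\mathbb R^d$, a.e. $x\in\Omega$. Set $\mathcal X=H^1_0(\Omega)\cap L^p(\Omega)$, $$a(v,w)=(\mathcal D\nabla v,\nabla w)_\Omega,\quad \|v\|_a=\sqrt{a(v,v)},\quad b(w;u,v)=(|w|^{p-2}u,v)_\Omega .$$ The continuous problem is the weak form of $-\mathrm{div}(\mathcal D\nabla u)+|u|^{p-2}u=f$ in $\Omega$, $u=0$ on $\partial\Omega$.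 Quasinorm. For $w\in L^p(\Omega)$ and $v\in L^p(\Omega)$, $\|v\|_{(w,p)}^2=\int_\Omega|v|^2(|w|+|v|)^{p-2}\,dx$. Finite elements. $\mathcal P$ is a conforming, shape-regular partition of $\Omega$ into simplices (or affine quadrilaterals/hexahedra) $K$ with diameters $h_K$; $h=\max_K h_K$; $k\ge1$; $V_{\mathcal P}$ is the space of functions in $C^0(\Omega)\cap H^1_0(\Omega)$ whose restriction to each $K$ is in $\mathbb P_k(K)$ (simplices) or $\mathbb Q_k(K)$ (affinely mapped polynomials of degree $\le k$ in each variable, for quadrilaterals/hexahedra). $x_1,\dots,x_N$ are the internal Lagrange nodes and $\phi_1,\dots,\phi_N$ the associated Lagrange basis of $V_{\mathcal P}$. For a node $x$, $K_x$ is the set of elements containing $x$ (also identified with their union). The mesh function $\mathfrak h$ is the continuous, element-wise linear (degree $k=1$) function whose value at each vertex $x$ of $\mathcal P$ is $\frac{1}{\#K_x}\sum_{K\in K_x}h_K$. $\omega_i$ is the union of all $K\in\mathcal P$ with $K\cap K_{x_i}\ne\emptyset$. Constrained and complementary parts. $\mathfrak a>0$ is a given constant, $V_{\mathcal P}^+=\{v_h\in V_{\mathcal P}: v_h(x_i)\in[0,\mathfrak a],\ i=1,\dots,N\}$. For $v_h\in V_{\mathcal P}$, $v_h^+=\sum_{i=1}^N\max\{0,\min\{v_h(x_i),\mathfrak a\}\}\phi_i$ and $v_h^-=v_h-v_h^+$. Stabilisation. For a constant $\alpha>0$, $$s(v,w)=\alpha\sum_{i=1}^N\|\mathcal D\|_{0,\infty,\omega_i}\,\mathfrak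 h(x_i)^{d-2}\,v(x_i)w(x_i),$$ where $\|\mathcal D\|_{0,\infty,\omega_i}$ is the $L^\infty(\omega_i)$-norm (with a fixed matrix norm). *)

theory Defs
  imports "HOL-Analysis.Analysis" "HOL-Probability.Essential_Supremum"
begin

section \<open>Domains\<close>

text \<open>Near each boundary point the domain is the strict epigraph of a Lipschitz function over the
  hyperplane orthogonal to a unit vector \<open>\<nu>\<close>. The function \<open>g\<close> is only evaluated on that hyperplane,
  so the definition also makes sense in dimension one, where the hyperplane is a point.\<close>

definition lipschitz_boundary :: "'a::euclidean_space set \<Rightarrow> bool" where
  "lipschitz_boundary \<Omega> \<longleftrightarrow>
     (\<forall>z\<in>frontier \<Omega>. \<exists>r>0. \<exists>\<nu> L. \<exists>g::'a \<Rightarrow> real. norm \<nu> = 1 \<and> L-lipschitz_on UNIV g \<and>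
        (\<forall>x\<in>ball z r. x \<in> \<Omega> \<longleftrightarrow> x \<bullet> \<nu> > g (x - (x \<bullet> \<nu>) *\<^sub>R \<nu>)))"

definition polyhedral_boundary :: "'a::euclidean_space set \<Rightarrow> bool" where
  "polyhedral_boundary \<Omega> \<longleftrightarrow>
     (\<exists>\<F>. finite \<F> \<and> (\<forall>F\<in>\<F>. polytope F) \<and> frontier \<Omega> = \<Union>\<F>)"

definition polyhedral_lipschitz_domain :: "'a::euclidean_space set \<Rightarrow> bool" where
  "polyhedral_lipschitz_domain \<Omega> \<longleftrightarrow>
     open \<Omega> \<and> connected \<Omega> \<and> \<Omega> \<noteq> {} \<and> bounded \<Omega> \<and>
     lipschitz_boundary \<Omega> \<and> polyhedral_boundary \<Omega>"


section \<open>Lebesgue and Sobolev spaces\<close>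

text \<open>Elements of the function spaces are represented by functions on the whole space of which only
  the values on \<open>\<Omega>\<close> matter; no quotient by almost-everywhere equality is taken.\<close>

definition Lp_space :: "(real^'d) set \<Rightarrow> real \<Rightarrow> (real^'d \<Rightarrow> real) set" where
  "Lp_space \<Omega> p = {v. v \<in> borel_measurable (lebesgue_on \<Omega>) \<and>
                      integrable (lebesgue_on \<Omega>) (\<lambda>x. \<bar>v x\<bar> powr p)}"

primrec Ck :: "nat \<Rightarrow> (real^'d \<Rightarrow> real) \<Rightarrow> bool" where
  "Ck 0 \<psi> \<longleftrightarrow> continuous_on UNIV \<psi>"
| "Ck (Suc n) \<psi> \<longleftrightarrow> (\<exists>G. (\<forall>x. GDERIV \<psi> x :> G x) \<and> (\<forall>i. Ck n (\<lambda>x. G x $ i)))"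

definition test_functions :: "(real^'d) set \<Rightarrow> (real^'d \<Rightarrow> real) set" where
  "test_functions \<Omega> =
     {\<psi>. (\<forall>n. Ck n \<psi>) \<and> (\<exists>S. compact S \<and> S \<subseteq> \<Omega> \<and> (\<forall>x. x \<notin> S \<longrightarrow> \<psi> x = 0))}"

definition is_weak_gradient ::
  "(real^'d) set \<Rightarrow> (real^'d \<Rightarrow> real) \<Rightarrow> (real^'d \<Rightarrow> real^'d) \<Rightarrow> bool" where
  "is_weak_gradient \<Omega> v G \<longleftrightarrow>
     (\<forall>i. (\<lambda>x. G x $ i) \<in> Lp_space \<Omega> 2) \<and>
     (\<forall>\<psi>\<in>test_functions \<Omega>. \<forall>i.
        (LINT x|lebesgue_on \<Omega>. v x * frechet_derivative \<psi> (at x) (axis i 1)) =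
        - (LINT x|lebesgue_on \<Omega>. G x $ i * \<psi> x))"

definition H1 :: "(real^'d) set \<Rightarrow> (real^'d \<Rightarrow> real) set" where
  "H1 \<Omega> = {v \<in> Lp_space \<Omega> 2. \<exists>G. is_weak_gradient \<Omega> v G}"

text \<open>The weak gradient is unique up to null sets; an arbitrary representative is selected.\<close>

definition wgrad :: "(real^'d) set \<Rightarrow> (real^'d \<Rightarrow> real) \<Rightarrow> real^'d \<Rightarrow> real^'d" where
  "wgrad \<Omega> v = (SOME G. is_weak_gradient \<Omega> v G)"

definition H1_norm :: "(real^'d) set \<Rightarrow> (real^'d \<Rightarrow> real) \<Rightarrow> real" where
  "H1_norm \<Omega> v = sqrt ((LINT x|lebesgue_on \<Omega>. (v x)\<^sup>2) +
                       (LINT x|lebesgue_on \<Omega>. (norm (wgrad \<Omega> v x))\<^sup>2))"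

definition H10 :: "(real^'d) set \<Rightarrow> (real^'d \<Rightarrow> real) set" where
  "H10 \<Omega> = {v \<in> H1 \<Omega>. \<forall>\<epsilon>>0. \<exists>\<psi>\<in>test_functions \<Omega>. H1_norm \<Omega> (\<lambda>x. v x - \<psi> x) < \<epsilon>}"

text \<open>The dual space of \<open>H10 \<Omega>\<close>; the duality pairing is function application. Boundedness makes a
  functional invariant under modification of its argument on a null set.\<close>

definition Hminus1 :: "(real^'d) set \<Rightarrow> ((real^'d \<Rightarrow> real) \<Rightarrow> real) set" where
  "Hminus1 \<Omega> =
     {f. (\<forall>v\<in>H10 \<Omega>. \<forall>w\<in>H10 \<Omega>. f (\<lambda>x. v x + w x) = f v + f w) \<and>
         (\<forall>c. \<forall>v\<in>H10 \<Omega>. f (\<lambda>x. c * v x) = c * f v) \<and>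
         (\<exists>M. \<forall>v\<in>H10 \<Omega>. \<bar>f v\<bar> \<le> M * H1_norm \<Omega> v)}"

definition X_space :: "(real^'d) set \<Rightarrow> real \<Rightarrow> (real^'d \<Rightarrow> real) set" where
  "X_space \<Omega> p = H10 \<Omega> \<inter> Lp_space \<Omega> p"


section \<open>Forms, energy norm and quasinorm\<close>

definition diffusion_tensor :: "(real^'d) set \<Rightarrow> (real^'d \<Rightarrow> real^'d^'d) \<Rightarrow> bool" where
  "diffusion_tensor \<Omega> D \<longleftrightarrow>
     D \<in> borel_measurable (lebesgue_on \<Omega>) \<and>
     (\<exists>M. AE x in lebesgue_on \<Omega>. norm (D x) \<le> M) \<and>
     (AE x in lebesgue_on \<Omega>. transpose (D x) = D x) \<and>
     (\<exists>d0>0. AE x in lebesgue_on \<Omega>. \<forall>y. y \<bullet> (D x *v y) \<ge> d0 * (norm y)\<^sup>2)"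

definition a_form ::
  "(real^'d) set \<Rightarrow> (real^'d \<Rightarrow> real^'d^'d) \<Rightarrow> (real^'d \<Rightarrow> real) \<Rightarrow> (real^'d \<Rightarrow> real) \<Rightarrow> real" where
  "a_form \<Omega> D v w = (LINT x|lebesgue_on \<Omega>. (D x *v wgrad \<Omega> v x) \<bullet> wgrad \<Omega> w x)"

definition a_norm ::
  "(real^'d) set \<Rightarrow> (real^'d \<Rightarrow> real^'d^'d) \<Rightarrow> (real^'d \<Rightarrow> real) \<Rightarrow> real" where
  "a_norm \<Omega> D v = sqrt (a_form \<Omega> D v v)"

text \<open>\<open>pow_m2 p t\<close> is \<open>t\<close> to the power \<open>p - 2\<close> for \<open>t \<ge> 0\<close> and \<open>p \<ge> 2\<close>. The case distinction is needed
  because \<open>0 powr 0 = 0\<close>, whereas the weight has to be identically one when \<open>p = 2\<close>.\<close>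

definition pow_m2 :: "real \<Rightarrow> real \<Rightarrow> real" where
  "pow_m2 p t = (if p = 2 then 1 else t powr (p - 2))"

definition b_form ::
  "(real^'d) set \<Rightarrow> real \<Rightarrow> (real^'d \<Rightarrow> real) \<Rightarrow> (real^'d \<Rightarrow> real) \<Rightarrow> (real^'d \<Rightarrow> real) \<Rightarrow> real" where
  "b_form \<Omega> p w u v = (LINT x|lebesgue_on \<Omega>. pow_m2 p \<bar>w x\<bar> * u x * v x)"

definition quasinorm ::
  "(real^'d) set \<Rightarrow> (real^'d \<Rightarrow> real) \<Rightarrow> real \<Rightarrow> (real^'d \<Rightarrow> real) \<Rightarrow> real" where
  "quasinorm \<Omega> w p v = sqrt (LINT x|lebesgue_on \<Omega>. \<bar>v x\<bar>\<^sup>2 * pow_m2 p (\<bar>w x\<bar> + \<bar>v x\<bar>))"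


section \<open>Partitions\<close>

definition affine_map :: "real^'d^'d \<Rightarrow> real^'d \<Rightarrow> real^'d \<Rightarrow> real^'d" where
  "affine_map B c \<xi> = c + B *v \<xi>"

text \<open>The sets obtained as images of the unit cube under \<open>affine_map B c\<close> with invertible \<open>B\<close> are the
  affine quadrilaterals (dimension two) and affine hexahedra (dimension three).\<close>

definition is_parallelotope :: "(real^'d) set \<Rightarrow> bool" where
  "is_parallelotope K \<longleftrightarrow> (\<exists>B c. invertible B \<and> K = affine_map B c ` cbox 0 1)"

definition is_partition :: "(real^'d) set \<Rightarrow> (real^'d) set set \<Rightarrow> bool" where
  "is_partition \<Omega> P \<longleftrightarrow>
     finite P \<and> \<Union>P = closure \<Omega> \<and>
     ((\<forall>K\<in>P. int CARD('d) simplex K) \<or> (\<forall>K\<in>P. is_parallelotope K)) \<and>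
     (\<forall>K\<in>P. \<forall>K'\<in>P. (K \<inter> K') face_of K \<and> (K \<inter> K') face_of K')"

definition inradius :: "(real^'d) set \<Rightarrow> real" where
  "inradius K = Sup {r. \<exists>z. cball z r \<subseteq> K}"

definition shape_regular :: "real \<Rightarrow> (real^'d) set set \<Rightarrow> bool" where
  "shape_regular \<sigma> P \<longleftrightarrow> (\<forall>K\<in>P. diameter K \<le> \<sigma> * (2 * inradius K))"

definition vertices :: "(real^'d) set \<Rightarrow> (real^'d) set" where
  "vertices K = {x. x extreme_point_of K}"

definition elements_at :: "(real^'d) set set \<Rightarrow> real^'d \<Rightarrow> (real^'d) set set" where
  "elements_at P x = {K\<in>P. x \<in> K}"

definition patch :: "(real^'d) set set \<Rightarrow> real^'d \<Rightarrow> (real^'d) set" where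
  "patch P x = \<Union>{K\<in>P. K \<inter> \<Union>(elements_at P x) \<noteq> {}}"


section \<open>Finite element spaces\<close>

definition monomial_fun :: "('d \<Rightarrow> nat) \<Rightarrow> real^'d \<Rightarrow> real" where
  "monomial_fun \<beta> x = (\<Prod>i\<in>UNIV. (x $ i) ^ \<beta> i)"

definition Pk :: "nat \<Rightarrow> (real^'d \<Rightarrow> real) set" where
  "Pk k = {q. \<exists>c. q = (\<lambda>x. \<Sum>\<beta> | (\<Sum>i\<in>UNIV. \<beta> i) \<le> k. c \<beta> * monomial_fun \<beta> x)}"

definition Qk :: "nat \<Rightarrow> (real^'d \<Rightarrow> real) set" where
  "Qk k = {q. \<exists>c. q = (\<lambda>x. \<Sum>\<beta> | (\<forall>i. \<beta> i \<le> k). c \<beta> * monomial_fun \<beta> x)}"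

text \<open>A fixed affine parametrisation of a parallelotope by the unit cube. The choice is immaterial:
  two such maps differ by a symmetry of the cube, which preserves \<open>Qk k\<close> and the grid of nodes.\<close>

definition ref_map :: "(real^'d) set \<Rightarrow> real^'d \<Rightarrow> real^'d" where
  "ref_map K = (SOME F. \<exists>B c. invertible B \<and> F = affine_map B c \<and> K = F ` cbox 0 1)"

text \<open>In dimension one every element is an interval, and the two branches of each of the following
  definitions agree.\<close>

definition local_space :: "nat \<Rightarrow> (real^'d) set \<Rightarrow> (real^'d \<Rightarrow> real) set" where
  "local_space k K =
     (if int CARD('d) simplex K then Pk k else {q. q \<circ> ref_map K \<in> Qk k})"

definition local_nodes :: "nat \<Rightarrow> (real^'d) set \<Rightarrow> (real^'d) set" where
  "local_nodes k K =
     (if int CARD('d) simplex K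
      then {(\<Sum>z\<in>vertices K. (real (m z) / real k) *\<^sub>R z) | m. (\<Sum>z\<in>vertices K. m z) = k}
      else {ref_map K (\<chi> i. real (m i) / real k) | m. \<forall>i. m i \<le> k})"

definition internal_nodes :: "(real^'d) set \<Rightarrow> (real^'d) set set \<Rightarrow> nat \<Rightarrow> (real^'d) set" where
  "internal_nodes \<Omega> P k = (\<Union>K\<in>P. local_nodes k K) \<inter> \<Omega>"

definition V_space :: "(real^'d) set \<Rightarrow> (real^'d) set set \<Rightarrow> nat \<Rightarrow> (real^'d \<Rightarrow> real) set" where
  "V_space \<Omega> P k = {v \<in> H10 \<Omega>. continuous_on \<Omega> v \<and>
     (\<forall>K\<in>P. \<exists>q\<in>local_space k K. \<forall>x\<in>K \<inter> \<Omega>. v x = q x)}"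

text \<open>The basis is indexed by the internal nodes themselves. Linear independence follows from
  the duality with the nodes.\<close>

definition is_lagrange_basis ::
  "(real^'d) set \<Rightarrow> (real^'d) set set \<Rightarrow> nat \<Rightarrow> (real^'d \<Rightarrow> real^'d \<Rightarrow> real) \<Rightarrow> bool" where
  "is_lagrange_basis \<Omega> P k \<phi> \<longleftrightarrow>
     (\<forall>y\<in>internal_nodes \<Omega> P k. \<phi> y \<in> V_space \<Omega> P k \<and>
        (\<forall>z\<in>internal_nodes \<Omega> P k. \<phi> y z = (if z = y then 1 else 0))) \<and>
     (\<forall>v\<in>V_space \<Omega> P k. \<exists>c. \<forall>x\<in>\<Omega>. v x = (\<Sum>y\<in>internal_nodes \<Omega> P k. c y * \<phi> y x))"

definition V_plus ::
  "(real^'d) set \<Rightarrow> (real^'d) set set \<Rightarrow> nat \<Rightarrow> real \<Rightarrow> (real^'d \<Rightarrow> real) set" where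
  "V_plus \<Omega> P k \<aa> = {v \<in> V_space \<Omega> P k. \<forall>y\<in>internal_nodes \<Omega> P k. 0 \<le> v y \<and> v y \<le> \<aa>}"

definition pos_part ::
  "(real^'d) set \<Rightarrow> (real^'d) set set \<Rightarrow> nat \<Rightarrow> (real^'d \<Rightarrow> real^'d \<Rightarrow> real) \<Rightarrow> real \<Rightarrow>
   (real^'d \<Rightarrow> real) \<Rightarrow> real^'d \<Rightarrow> real" where
  "pos_part \<Omega> P k \<phi> \<aa> v x = (\<Sum>y\<in>internal_nodes \<Omega> P k. max 0 (min (v y) \<aa>) * \<phi> y x)"

definition neg_part ::
  "(real^'d) set \<Rightarrow> (real^'d) set set \<Rightarrow> nat \<Rightarrow> (real^'d \<Rightarrow> real^'d \<Rightarrow> real) \<Rightarrow> real \<Rightarrow>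
   (real^'d \<Rightarrow> real) \<Rightarrow> real^'d \<Rightarrow> real" where
  "neg_part \<Omega> P k \<phi> \<aa> v x = v x - pos_part \<Omega> P k \<phi> \<aa> v x"


section \<open>Stabilisation\<close>

definition is_mesh_function ::
  "(real^'d) set \<Rightarrow> (real^'d) set set \<Rightarrow> (real^'d \<Rightarrow> real) \<Rightarrow> bool" where
  "is_mesh_function \<Omega> P \<hh> \<longleftrightarrow>
     continuous_on (closure \<Omega>) \<hh> \<and>
     (\<forall>K\<in>P. \<exists>q\<in>local_space 1 K. \<forall>x\<in>K. \<hh> x = q x) \<and>
     (\<forall>K\<in>P. \<forall>x\<in>vertices K.
        \<hh> x = (\<Sum>K'\<in>elements_at P x. diameter K') / real (card (elements_at P x)))"

definition is_matrix_norm :: "(real^'d^'d \<Rightarrow> real) \<Rightarrow> bool" where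
  "is_matrix_norm N \<longleftrightarrow>
     (\<forall>A. 0 \<le> N A) \<and> (\<forall>A. N A = 0 \<longleftrightarrow> A = 0) \<and>
     (\<forall>c A. N (c *\<^sub>R A) = \<bar>c\<bar> * N A) \<and> (\<forall>A B. N (A + B) \<le> N A + N B)"

text \<open>\<open>D\<close> lives on \<open>\<Omega>\<close>, so the null set \<open>\<omega> - \<Omega>\<close>, on which it is not controlled, is discarded.\<close>

definition Linf_norm ::
  "(real^'d) set \<Rightarrow> (real^'d^'d \<Rightarrow> real) \<Rightarrow> (real^'d \<Rightarrow> real^'d^'d) \<Rightarrow> (real^'d) set \<Rightarrow> real" where
  "Linf_norm \<Omega> N D \<omega> = real_of_ereal (esssup (lebesgue_on (\<omega> \<inter> \<Omega>)) (\<lambda>x. ereal (N (D x))))"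

text \<open>The mesh function is positive, so \<open>powr\<close> is the ordinary power with exponent \<open>d - 2\<close>,
  which is negative when \<open>d = 1\<close>.\<close>

definition s_form ::
  "(real^'d) set \<Rightarrow> (real^'d \<Rightarrow> real^'d^'d) \<Rightarrow> (real^'d^'d \<Rightarrow> real) \<Rightarrow> real \<Rightarrow> (real^'d) set set \<Rightarrow> nat \<Rightarrow>
   (real^'d \<Rightarrow> real) \<Rightarrow> (real^'d \<Rightarrow> real) \<Rightarrow> (real^'d \<Rightarrow> real) \<Rightarrow> real" where
  "s_form \<Omega> D N \<alpha> P k \<hh> v w =
     \<alpha> * (\<Sum>y\<in>internal_nodes \<Omega> P k.
            Linf_norm \<Omega> N D (patch P y) * \<hh> y powr (real CARD('d) - 2) * v y * w y)"

end

theory Submission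
  imports Defs
begin

text \<open>
  Truncation of the nodal values to \<open>[0, \<aa>]\<close> is a projection, so
  \<open>s(u\<^sub>h\<^sup>-, v - u\<^sub>h\<^sup>+) \<le> 0\<close> for every admissible \<open>v\<close>. Hence \<open>w = u\<^sub>h\<^sup>+\<close> solves the variational
  inequality \<open>a(w, v - w) + b(w; w, v - w) \<ge> \<langle>f, v - w\<rangle>\<close>, while \<open>u\<close> satisfies the corresponding
  equation. Subtracting gives
  \<open>a(u - w, u - w) + \<integral> F (u - w) \<le> a(u - w, u - v) + \<integral> F (u - v)\<close> with
  \<open>F = |u|\<^sup>p\<^sup>-\<^sup>2 u - |w|\<^sup>p\<^sup>-\<^sup>2 w\<close>. The form \<open>a\<close> is handled by Young's inequality, and \<open>F\<close> by its strong
  monotonicity and Lipschitz continuity measured in the quasinorm together with a quasinorm version of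
  Young's inequality. The resulting constant depends on \<open>p\<close> only. Bilinearity of \<open>a\<close> on weak gradients
  rests on the fundamental lemma of the calculus of variations.
\<close>

section \<open>The power nonlinearity\<close>

text \<open>The weight of the quasinorm contains the error itself, so no Cauchy-Schwarz inequality
  with a fixed weight applies. The nonlinear estimate is therefore made pointwise: one inequality
  between real numbers bounds \<open>F * (u - v)\<close> by half of \<open>F * (u - w)\<close> plus
  a multiple of the quasinorm density of \<open>u - v\<close>. That half, like the one in Young's
  inequality for the energy, lets the error be absorbed on the left. Both equations are tested with
  the same function \<open>v - w\<close>, so the values of \<open>f\<close> cancel.

  Much of the development serves the function spaces. \<open>wgrad\<close> is an arbitrary
  representative, so additivity of \<open>a_form\<close> has to come from uniqueness of weak
  gradients. Closing \<open>H10\<close> under sums needs test functions to lie in \<open>H1\<close>,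
  hence an integration by parts: \<open>H1_norm\<close> of \<open>v - \<psi>\<close> says nothing
  about a gradient unless \<open>v - \<psi>\<close> has one. These facts put the truncated function
  and \<open>v - w\<close> into the discrete space, and that space into
  \<open>X_space\<close>.\<close>

lemma pow_m2_nonneg [simp]: "0 \<le> pow_m2 p t"
  by (simp add: pow_m2_def)

lemma pow_m2_mono:
  assumes "2 \<le> p" "0 \<le> s" "s \<le> t" shows "pow_m2 p s \<le> pow_m2 p t"
  using assms by (auto simp: pow_m2_def intro!: powr_mono2)

lemma pow_m2_mult:
  assumes "0 \<le> c" "0 \<le> t" shows "pow_m2 p (c * t) = pow_m2 p c * pow_m2 p t"
  using assms by (simp add: pow_m2_def powr_mult)

lemma pow_m2_pos: "0 < c \<Longrightarrow> 0 < pow_m2 p c"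
  by (simp add: pow_m2_def)

lemma power2_mult_pow_m2:
  assumes "2 \<le> p" "0 \<le> t" shows "t\<^sup>2 * pow_m2 p t = t powr p"
proof (cases "t = 0 \<or> p = 2")
  case False
  then have "t\<^sup>2 * pow_m2 p t = t powr 2 * t powr (p - 2)"
    using assms by (simp add: pow_m2_def)
  also have "\<dots> = t powr p" by (simp flip: powr_add)
  finally show ?thesis .
qed (use assms in \<open>auto simp: pow_m2_def\<close>)

text \<open>A mean value argument would meet the unbounded derivative of
  \<open>t powr (p - 2)\<close> at 0 when \<open>2 < p < 3\<close>. Enlarging the factor
  \<open>y\<close> to \<open>x\<close> and setting \<open>r = y / x\<close> leaves
  \<open>1 - r powr (p - 2) \<le> p * (1 - r)\<close>, a form of Bernoulli's inequality.\<close>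

lemma pow_m2_diff_mult_le:
  assumes p: "2 \<le> p" and y: "0 \<le> y" and yx: "y \<le> x"
  shows "(pow_m2 p x - pow_m2 p y) * y \<le> p * (x - y) * pow_m2 p x"
proof (cases "y = 0 \<or> p = 2")
  case True
  then show ?thesis using assms by (auto simp: pow_m2_def)
next
  case False
  define r where "r = y / x"
  have x: "0 < x" and r: "0 < r" "r \<le> 1" and y_eq: "y = r * x"
    using False assms by (auto simp: r_def)
  \<comment> \<open>Bernoulli's inequality is used with an integer exponent: rounding up can only
    lower a power of \<open>r \<le> 1\<close>, and it keeps the constant below
    \<open>p\<close>.\<close>
  define n where "n = nat \<lceil>p - 2\<rceil>"
  have n: "p - 2 \<le> real n" "real n \<le> p" using p by (auto simp: n_def) linarith+
  have "1 - p * (1 - r) \<le> 1 + real n * (r - 1)"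
    using mult_right_mono[OF n(2), of "1 - r"] r by (simp add: algebra_simps)
  also have "\<dots> \<le> (1 + (r - 1)) ^ n" using r by (intro Bernoulli_inequality) simp
  also have "\<dots> = r powr real n" using r by (simp add: powr_realpow)
  also have "\<dots> \<le> r powr (p - 2)" using n r by (intro powr_mono') auto
  also have "\<dots> = pow_m2 p r" using False by (simp add: pow_m2_def)
  finally have "1 - pow_m2 p r \<le> p * (1 - r)" by simp
  then have "(1 - pow_m2 p r) * (pow_m2 p x * x) \<le> p * (1 - r) * (pow_m2 p x * x)"
    using x by (intro mult_right_mono) auto
  then have *: "(pow_m2 p x - pow_m2 p y) * x \<le> p * (x - y) * pow_m2 p x"
    using x r by (simp add: y_eq pow_m2_mult algebra_simps)
  have "(pow_m2 p x - pow_m2 p y) * y \<le> (pow_m2 p x - pow_m2 p y) * x"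
    using pow_m2_mono[OF p y yx] yx by (intro mult_left_mono) auto
  with * show ?thesis by simp
qed

text \<open>The larger argument keeps its weight, and the change of weight is charged to
  \<open>pow_m2_diff_mult_le\<close>. The resulting weight in max(|a|, |b|) is then enlarged to one
  in |a| + |a - b|, the form in which the quasinorm measures.\<close>

lemma power_nonlinearity_lipschitz:
  assumes p: "2 \<le> p"
  shows "\<bar>pow_m2 p \<bar>a\<bar> * a - pow_m2 p \<bar>b\<bar> * b\<bar> \<le> (1 + p) * \<bar>a - b\<bar> * pow_m2 p (\<bar>a\<bar> + \<bar>a - b\<bar>)"
proof -
  have *: "\<bar>pow_m2 p \<bar>x\<bar> * x - pow_m2 p \<bar>y\<bar> * y\<bar> \<le> (1 + p) * \<bar>x - y\<bar> * pow_m2 p \<bar>x\<bar>"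
    if "\<bar>y\<bar> \<le> \<bar>x\<bar>" for x y
  proof -
    have "(pow_m2 p \<bar>x\<bar> - pow_m2 p \<bar>y\<bar>) * \<bar>y\<bar> \<le> p * (\<bar>x\<bar> - \<bar>y\<bar>) * pow_m2 p \<bar>x\<bar>"
      using p that by (intro pow_m2_diff_mult_le) auto
    also have "\<dots> \<le> p * \<bar>x - y\<bar> * pow_m2 p \<bar>x\<bar>"
      using p by (intro mult_right_mono mult_left_mono) auto
    finally have 1: "(pow_m2 p \<bar>x\<bar> - pow_m2 p \<bar>y\<bar>) * \<bar>y\<bar> \<le> p * \<bar>x - y\<bar> * pow_m2 p \<bar>x\<bar>" .
    have "pow_m2 p \<bar>x\<bar> * x - pow_m2 p \<bar>y\<bar> * y
          = pow_m2 p \<bar>x\<bar> * (x - y) + (pow_m2 p \<bar>x\<bar> - pow_m2 p \<bar>y\<bar>) * y"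
      by (simp add: algebra_simps)
    also have "\<bar>\<dots>\<bar> \<le> pow_m2 p \<bar>x\<bar> * \<bar>x - y\<bar> + (pow_m2 p \<bar>x\<bar> - pow_m2 p \<bar>y\<bar>) * \<bar>y\<bar>"
      using pow_m2_mono[OF p _ that]
      by (intro order_trans[OF abs_triangle_ineq]) (simp add: abs_mult)
    finally show ?thesis using 1 by (simp add: algebra_simps)
  qed
  have "\<bar>pow_m2 p \<bar>a\<bar> * a - pow_m2 p \<bar>b\<bar> * b\<bar> \<le> (1 + p) * \<bar>a - b\<bar> * pow_m2 p (max \<bar>a\<bar> \<bar>b\<bar>)"
    using *[of b a] *[of a b] by (auto simp: max_def abs_minus_commute)
  also have "\<dots> \<le> (1 + p) * \<bar>a - b\<bar> * pow_m2 p (\<bar>a\<bar> + \<bar>a - b\<bar>)"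
    using p by (intro mult_left_mono pow_m2_mono) auto
  finally show ?thesis .
qed

text \<open>With the weights A of \<open>a\<close> and B of \<open>b\<close>, twice (A a - B b)(a -
  b) equals (A + B)(a - b)^2 + (A - B)(a^2 - b^2), and the last term is nonnegative because the
  weights are ordered like |a| and |b|. The 2 comes from this identity, the 3 from |a| + |a - b|
  \<le> 3 max(|a|, |b|).\<close>

lemma power_nonlinearity_strongly_monotone:
  assumes p: "2 \<le> p"
  shows "(a - b)\<^sup>2 * pow_m2 p (\<bar>a\<bar> + \<bar>a - b\<bar>)
         \<le> 2 * pow_m2 p 3 * ((pow_m2 p \<bar>a\<bar> * a - pow_m2 p \<bar>b\<bar> * b) * (a - b))"
proof -
  let ?A = "pow_m2 p \<bar>a\<bar>" and ?B = "pow_m2 p \<bar>b\<bar>"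
  have "pow_m2 p (\<bar>a\<bar> + \<bar>a - b\<bar>) \<le> pow_m2 p (3 * max \<bar>a\<bar> \<bar>b\<bar>)"
    using p by (intro pow_m2_mono) auto
  also have "\<dots> = pow_m2 p 3 * pow_m2 p (max \<bar>a\<bar> \<bar>b\<bar>)" by (simp add: pow_m2_mult)
  also have "\<dots> \<le> pow_m2 p 3 * (?A + ?B)"
    by (intro mult_left_mono) (auto simp: max_def)
  finally have "(a - b)\<^sup>2 * pow_m2 p (\<bar>a\<bar> + \<bar>a - b\<bar>) \<le> (a - b)\<^sup>2 * (pow_m2 p 3 * (?A + ?B))"
    by (intro mult_left_mono) auto
  also have "\<dots> = pow_m2 p 3 * ((?A + ?B) * (a - b)\<^sup>2)" by simp
  also have "\<dots> \<le> pow_m2 p 3 * ((?A + ?B) * (a - b)\<^sup>2 + (?A - ?B) * (\<bar>a\<bar>\<^sup>2 - \<bar>b\<bar>\<^sup>2))"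
  proof -
    have "0 \<le> (?A - ?B) * (\<bar>a\<bar>\<^sup>2 - \<bar>b\<bar>\<^sup>2)"
    proof (cases "\<bar>a\<bar> \<le> \<bar>b\<bar>")
      case True
      then show ?thesis
        using pow_m2_mono[OF p _ True] power_mono[OF True, of 2]
        by (intro mult_nonpos_nonpos) auto
    next
      case False
      then have "\<bar>b\<bar> \<le> \<bar>a\<bar>" by simp
      then show ?thesis
        using pow_m2_mono[OF p _ \<open>\<bar>b\<bar> \<le> \<bar>a\<bar>\<close>] power_mono[OF \<open>\<bar>b\<bar> \<le> \<bar>a\<bar>\<close>, of 2]
        by (intro mult_nonneg_nonneg) auto
    qed
    then show ?thesis by (intro mult_left_mono) auto
  qed
  also have "\<dots> = 2 * pow_m2 p 3 * ((?A * a - ?B * b) * (a - b))"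
    by (simp add: algebra_simps power2_eq_square)
  finally show ?thesis .
qed

text \<open>Splitting at \<open>t = \<delta> * s\<close> replaces convex conjugates. Below the
  threshold the product is absorbed in the first term. Above it \<open>s \<le> t / \<delta>\<close>,
  and \<delta> \<le> 1 gives \<open>A + s \<le> (A + t) / \<delta>\<close>, which moves the weight
  from \<open>s\<close> to \<open>t\<close> at the price
  \<open>pow_m2 p (1 / \<delta>)\<close>.\<close>

lemma quasinorm_young:
  fixes A s t \<delta> :: real
  assumes p: "2 \<le> p" and "0 \<le> A" "0 \<le> s" "0 \<le> t" and \<delta>: "0 < \<delta>" "\<delta> \<le> 1"
  shows "s * pow_m2 p (A + s) * t
         \<le> \<delta> * (s\<^sup>2 * pow_m2 p (A + s)) + pow_m2 p (1 / \<delta>) / \<delta> * (t\<^sup>2 * pow_m2 p (A + t))"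
proof (cases "t \<le> \<delta> * s")
  case True
  then have "s * pow_m2 p (A + s) * t \<le> s * pow_m2 p (A + s) * (\<delta> * s)"
    using assms by (intro mult_left_mono) auto
  moreover have "0 \<le> pow_m2 p (1 / \<delta>) / \<delta> * (t\<^sup>2 * pow_m2 p (A + t))"
    using \<delta> by simp
  ultimately show ?thesis by (simp add: power2_eq_square mult_ac)
next
  case False
  then have s: "s \<le> t / \<delta>" using \<delta> by (simp add: field_simps)
  have "A + s \<le> 1 / \<delta> * (A + t)"
    using s \<delta> mult_right_mono[OF \<delta>(2), of A] assms(2) by (simp add: field_simps)
  then have "pow_m2 p (A + s) \<le> pow_m2 p (1 / \<delta> * (A + t))"
    using assms by (intro pow_m2_mono) auto
  also have "\<dots> = pow_m2 p (1 / \<delta>) * pow_m2 p (A + t)"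
    using assms by (intro pow_m2_mult) auto
  finally have "s * pow_m2 p (A + s) * t
      \<le> t / \<delta> * (pow_m2 p (1 / \<delta>) * pow_m2 p (A + t)) * t"
    using assms s by (intro mult_right_mono mult_mono) auto
  moreover have "0 \<le> \<delta> * (s\<^sup>2 * pow_m2 p (A + s))" using \<delta> by simp
  ultimately show ?thesis by (simp add: power2_eq_square mult_ac)
qed

lemma power_nonlinearity_young:
  assumes p: "2 \<le> p"
  obtains C where "0 < C" and "\<And>a b c. (pow_m2 p \<bar>a\<bar> * a - pow_m2 p \<bar>b\<bar> * b) * (a - c)
     \<le> (pow_m2 p \<bar>a\<bar> * a - pow_m2 p \<bar>b\<bar> * b) * (a - b) / 2
        + C * ((a - c)\<^sup>2 * pow_m2 p (\<bar>a\<bar> + \<bar>a - c\<bar>))"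
proof -
  \<comment> \<open>Chosen so that the Lipschitz constant \<open>1 + p\<close> times the
    monotonicity constant \<open>2 * pow_m2 p 3\<close> leaves at most 1/2 in front of
    \<open>?F * (a - b)\<close>. The added 1 gives \<open>R \<ge> 1\<close>, hence \<delta> \<le> 1,
    at once.\<close>
  define R where "R = 4 * (1 + p) * (1 + pow_m2 p 3)"
  define \<delta> where "\<delta> = 1 / R"
  define C where "C = (1 + p) * (pow_m2 p (1 / \<delta>) / \<delta>)"
  have "1 * 1 \<le> R" unfolding R_def
    using p by (intro mult_mono) auto
  then have \<delta>: "0 < \<delta>" "\<delta> \<le> 1" and R: "0 < R" by (auto simp: \<delta>_def)
  have "0 < C" using p \<delta> by (simp add: C_def pow_m2_pos)
  moreover have "(pow_m2 p \<bar>a\<bar> * a - pow_m2 p \<bar>b\<bar> * b) * (a - c)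
     \<le> (pow_m2 p \<bar>a\<bar> * a - pow_m2 p \<bar>b\<bar> * b) * (a - b) / 2
        + C * ((a - c)\<^sup>2 * pow_m2 p (\<bar>a\<bar> + \<bar>a - c\<bar>))" (is "?F * _ \<le> ?F * _ / 2 + C * ?Q") for a b c
  proof -
    let ?S = "(a - b)\<^sup>2 * pow_m2 p (\<bar>a\<bar> + \<bar>a - b\<bar>)"
    have FS: "?S \<le> 2 * pow_m2 p 3 * (?F * (a - b))"
      using p by (rule power_nonlinearity_strongly_monotone)
    have F0: "0 \<le> ?F * (a - b)"
    proof -
      have "0 \<le> ?S" by simp
      then have "0 \<le> 2 * pow_m2 p 3 * (?F * (a - b))" using FS by linarith
      moreover have "0 < 2 * pow_m2 p 3" by (simp add: pow_m2_pos)
      ultimately show ?thesis by (metis zero_le_mult_iff not_le)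
    qed
    have "?F * (a - c) \<le> \<bar>?F\<bar> * \<bar>a - c\<bar>" by (metis abs_ge_self abs_mult)
    also have "\<dots> \<le> (1 + p) * \<bar>a - b\<bar> * pow_m2 p (\<bar>a\<bar> + \<bar>a - b\<bar>) * \<bar>a - c\<bar>"
      using p by (intro mult_right_mono power_nonlinearity_lipschitz) auto
    also have "\<dots> = (1 + p) * (\<bar>a - b\<bar> * pow_m2 p (\<bar>a\<bar> + \<bar>a - b\<bar>) * \<bar>a - c\<bar>)" by simp
    also have "\<dots> \<le> (1 + p) * (\<delta> * ?S + pow_m2 p (1 / \<delta>) / \<delta> * ?Q)"
      using quasinorm_young[OF p, of "\<bar>a\<bar>" "\<bar>a - b\<bar>" "\<bar>a - c\<bar>" \<delta>] \<delta> p
      by (intro mult_left_mono) auto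
    also have "\<dots> = (1 + p) * \<delta> * ?S + C * ?Q" by (simp add: C_def algebra_simps)
    also have "(1 + p) * \<delta> * ?S \<le> (1 + p) * \<delta> * (2 * pow_m2 p 3 * (?F * (a - b)))"
      using FS p \<delta> by (intro mult_left_mono) auto
    also have "\<dots> = (2 * (1 + p) * pow_m2 p 3 * \<delta>) * (?F * (a - b))"
      by (simp add: algebra_simps)
    also have "\<dots> \<le> 1 / 2 * (?F * (a - b))"
    proof (rule mult_right_mono[OF _ F0])
      have "2 * (1 + p) * pow_m2 p 3 \<le> 2 * (1 + p) * (1 + pow_m2 p 3)"
        using p by (intro mult_left_mono) auto
      then show "2 * (1 + p) * pow_m2 p 3 * \<delta> \<le> 1 / 2"
        using R by (simp add: \<delta>_def field_simps R_def)
    qed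
    finally show ?thesis by simp
  qed
  ultimately show thesis by (rule that)
qed

section \<open>Smooth functions and bump functions\<close>

text \<open>Needed for the product rule, where one factor stays undifferentiated. At the bottom it
  is continuity of differentiable functions, which the recursion does not ask for
  separately.\<close>

lemma Ck_Suc_imp: "Ck (Suc n) f \<Longrightarrow> Ck n f"
proof (induction n arbitrary: f)
  case 0
  then obtain G where "\<forall>x. GDERIV f x :> G x" by auto
  then have "isCont f x" for x by (metis gderiv_def has_derivative_continuous)
  then show ?case by (simp add: continuous_at_imp_continuous_on)
next
  case (Suc n)
  then obtain G where "\<forall>x. GDERIV f x :> G x" "\<forall>i. Ck (Suc n) (\<lambda>x. G x $ i)"
    by (metis Ck.simps(2))
  with Suc.IH show ?case by (metis Ck.simps(2))
qed

lemma Ck_imp_continuous: "Ck n f \<Longrightarrow> continuous_on UNIV f"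
  by (induction n) (use Ck_Suc_imp in \<open>auto simp del: Ck.simps(2)\<close>)

lemma Ck_const: "Ck n (\<lambda>x. c)"
  by (induction n arbitrary: c) (auto intro!: exI[of _ "\<lambda>_. 0"] GDERIV_const)

lemma Ck_lincomb: "Ck n f \<Longrightarrow> Ck n g \<Longrightarrow> Ck n (\<lambda>x. a * f x + b * g x)"
proof (induction n arbitrary: f g)
  case 0
  then show ?case by (auto intro!: continuous_intros)
next
  case (Suc n)
  obtain F where F: "\<And>x. GDERIV f x :> F x" "\<And>i. Ck n (\<lambda>x. F x $ i)" using Suc.prems(1) by auto
  obtain G where G: "\<And>x. GDERIV g x :> G x" "\<And>i. Ck n (\<lambda>x. G x $ i)" using Suc.prems(2) by auto
  have "GDERIV (\<lambda>x. a * f x + b * g x) x :> a *\<^sub>R F x + b *\<^sub>R G x" for x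
    using GDERIV_add[OF GDERIV_mult[OF GDERIV_const F(1)] GDERIV_mult[OF GDERIV_const G(1)]]
    by simp
  moreover have "Ck n (\<lambda>x. (a *\<^sub>R F x + b *\<^sub>R G x) $ i)" for i
    using Suc.IH[OF F(2) G(2)] by simp
  ultimately show ?case by (auto intro!: exI[of _ "\<lambda>x. a *\<^sub>R F x + b *\<^sub>R G x"])
qed

lemma Ck_mult: "Ck n f \<Longrightarrow> Ck n g \<Longrightarrow> Ck n (\<lambda>x. f x * g x)"
proof (induction n arbitrary: f g)
  case 0
  then show ?case by (auto intro!: continuous_intros)
next
  case (Suc n)
  obtain F where F: "\<And>x. GDERIV f x :> F x" "\<And>i. Ck n (\<lambda>x. F x $ i)" using Suc.prems(1) by auto
  obtain G where G: "\<And>x. GDERIV g x :> G x" "\<And>i. Ck n (\<lambda>x. G x $ i)" using Suc.prems(2) by auto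
  have fg: "Ck n f" "Ck n g" using Suc.prems Ck_Suc_imp by blast+
  have "GDERIV (\<lambda>x. f x * g x) x :> f x *\<^sub>R G x + g x *\<^sub>R F x" for x
    by (rule GDERIV_mult[OF F(1) G(1)])
  moreover have "Ck n (\<lambda>x. (f x *\<^sub>R G x + g x *\<^sub>R F x) $ i)" for i
    using Ck_lincomb[OF Suc.IH[OF fg(1) G(2)[of i]] Suc.IH[OF fg(2) F(2)[of i]], of 1 1] by simp
  ultimately show ?case by (auto intro!: exI[of _ "\<lambda>x. f x *\<^sub>R G x + g x *\<^sub>R F x"])
qed

lemma Ck_prod: "(\<And>i. i \<in> I \<Longrightarrow> Ck n (f i)) \<Longrightarrow> Ck n (\<lambda>x. \<Prod>i\<in>I. f i x)"
  by (induction I rule: infinite_finite_induct) (auto intro: Ck_mult Ck_const)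

text \<open>The linear span of this family is closed under differentiation, which makes \<open>flat 0\<close> smooth.\<close>

definition flat :: "nat \<Rightarrow> real \<Rightarrow> real" where
  "flat m t = (if 0 < t then (1 / t) ^ m * exp (- (1 / t)) else 0)"

lemma flat_tendsto_0: "(flat m \<longlongrightarrow> 0) (at 0)"
proof -
  have "((\<lambda>t. (1 / t) ^ m * exp (- (1 / t))) \<longlongrightarrow> 0) (at_right (0::real))"
    using filterlim_compose[OF tendsto_power_div_exp_0 filterlim_inverse_at_top_right, of m]
    by (simp add: divide_inverse exp_minus)
  then have "(flat m \<longlongrightarrow> 0) (at_right 0)"
    by (rule Lim_transform_eventually)
      (auto simp: flat_def eventually_at_filter)
  moreover have "(flat m \<longlongrightarrow> 0) (at_left 0)"
    by (rule Lim_transform_eventually[OF tendsto_const])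
      (auto simp: flat_def eventually_at_filter)
  ultimately show ?thesis by (simp add: filterlim_split_at)
qed

lemma DERIV_flat: "DERIV (flat m) t :> flat (m + 2) t - real m * flat (m + 1) t"
proof -
  consider "t < 0" | "t = 0" | "0 < t" by linarith
  then show ?thesis
  proof cases
    case 1
    have "DERIV (\<lambda>_. 0::real) t :> flat (m + 2) t - real m * flat (m + 1) t"
      using 1 by (simp add: flat_def)
    then show ?thesis
      by (rule DERIV_cong_ev[THEN iffD1, rotated -1, OF _ refl _ refl])
        (use 1 eventually_nhds_in_open[of "{..<0}" t] in \<open>auto elim!: eventually_mono simp: flat_def\<close>)
  next
    case 2
    \<comment> \<open>The difference quotient at 0 is \<open>flat (Suc m)\<close>, so
      differentiability there is the decay of the next member of the family.\<close>
    have "((\<lambda>h. (flat m (0 + h) - flat m 0) / h) \<longlongrightarrow> 0) (at 0)"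
      by (rule Lim_transform_eventually[OF flat_tendsto_0[of "Suc m"]])
        (auto simp: flat_def eventually_at_filter)
    then show ?thesis using 2 by (simp add: DERIV_def flat_def)
  next
    case 3
    have inv: "((\<lambda>t. 1 / t) has_real_derivative - ((1 / t)\<^sup>2)) (at t)"
      using 3 by (auto intro!: derivative_eq_intros simp: power2_eq_square)
    have "DERIV (\<lambda>y::real. y ^ m * exp (- y)) y :>
        (real m * y ^ (m - Suc 0) - y ^ m) * exp (- y)" for y
      by (auto intro!: derivative_eq_intros simp: algebra_simps)
    from DERIV_chain2[OF this inv]
    have "DERIV (\<lambda>t. (1 / t) ^ m * exp (- (1 / t))) t :>
        (1 / t) ^ (m + 2) * exp (- (1 / t)) - real m * ((1 / t) ^ (m + 1) * exp (- (1 / t)))"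
      by (rule DERIV_cong) (cases m; simp del: power_one_over add: algebra_simps power2_eq_square add_divide_distrib)
    then have "DERIV (\<lambda>t. (1 / t) ^ m * exp (- (1 / t))) t
        :> flat (m + 2) t - real m * flat (m + 1) t"
      using 3 by (simp add: flat_def)
    then show ?thesis
      by (rule DERIV_cong_ev[THEN iffD1, rotated -1, OF _ refl _ refl])
        (use 3 eventually_nhds_in_open[of "{0<..}" t] in \<open>auto elim!: eventually_mono simp: flat_def\<close>)
  qed
qed

text \<open>The index \<open>m\<close> varies in the induction because each derivative raises it by
  one or two. The affine argument in one coordinate is the shape of the factors of
  \<open>box_bump\<close>.\<close>

lemma Ck_flat: "Ck n (\<lambda>x. flat m (c * x $ i + e))"
proof (induction n arbitrary: m)
  have lin: "((\<lambda>x. c * x $ i + e) has_derivative (\<lambda>h. h \<bullet> (c *\<^sub>R axis i 1))) (at x)" for x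
    by (auto intro!: derivative_eq_intros simp: inner_axis
        bounded_linear_imp_has_derivative[OF bounded_linear_vec_nth])
  have deriv: "GDERIV (\<lambda>x. flat m (c * x $ i + e)) x :>
      (flat (m + 2) (c * x $ i + e) - real m * flat (m + 1) (c * x $ i + e)) *\<^sub>R c *\<^sub>R axis i 1"
    for m x
    by (rule GDERIV_DERIV_compose[OF _ DERIV_flat]) (use lin in \<open>simp add: gderiv_def\<close>)
  {
    case 0
    have "isCont (\<lambda>x. flat m (c * x $ i + e)) x" for x
      using deriv[of m x] has_derivative_continuous by (auto simp: gderiv_def)
    then show ?case by (simp add: continuous_at_imp_continuous_on)
  next
    case (Suc n)
    have "Ck n (\<lambda>x. ((flat (m + 2) (c * x $ i + e) - real m * flat (m + 1) (c * x $ i + e))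
             *\<^sub>R c *\<^sub>R axis i 1) $ j)" for j
      using Ck_lincomb[OF Suc.IH[of "m + 2"] Suc.IH[of "m + 1"], of "c * axis i 1 $ j" "- real m * c * axis i 1 $ j"]
      by (simp add: algebra_simps)
    then show ?case unfolding Ck.simps using deriv
      by (intro exI[of _ "\<lambda>x. (flat (m + 2) (c * x $ i + e) - real m * flat (m + 1) (c * x $ i + e))
             *\<^sub>R c *\<^sub>R axis i 1"]) simp
  }
qed

text \<open>Smooth approximation of the indicator of an open box from within: for
  \<open>s > 0\<close> the factor \<open>flat 0 (n * s)\<close> is exp(-1 / (n s)) and tends to 1,
  for \<open>s \<le> 0\<close> it is 0. All members vanish off the same box, so no convolution is
  involved.\<close>

definition box_bump :: "real^'d \<Rightarrow> real^'d \<Rightarrow> nat \<Rightarrow> real^'d \<Rightarrow> real" where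
  "box_bump a b n x =
     (\<Prod>i\<in>UNIV. flat 0 (real n * x $ i + - real n * a $ i) * flat 0 (- real n * x $ i + real n * b $ i))"

lemma flat0_bounds: "0 \<le> flat 0 t" "flat 0 t \<le> 1"
  by (auto simp: flat_def)

lemma box_bump_bounds: "0 \<le> box_bump a b n x" "box_bump a b n x \<le> 1"
  by (auto simp: box_bump_def intro!: prod_nonneg prod_le_1 mult_nonneg_nonneg mult_le_one flat0_bounds)

lemma box_bump_eq_0: "x \<notin> box a b \<Longrightarrow> box_bump a b n x = 0"
proof -
  assume "x \<notin> box a b"
  then obtain i where "x $ i \<le> a $ i \<or> b $ i \<le> x $ i" by (auto simp: mem_box_cart not_less)
  then have "real n * x $ i \<le> real n * a $ i \<or> real n * b $ i \<le> real n * x $ i"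
    by (meson mult_left_mono of_nat_0_le_iff)
  then have "flat 0 (real n * x $ i + - real n * a $ i) = 0 \<or> flat 0 (- real n * x $ i + real n * b $ i) = 0"
    by (auto simp: flat_def)
  then show ?thesis by (auto simp: box_bump_def intro!: prod_zero bexI[of _ i])
qed

lemma box_bump_tendsto: "(\<lambda>n. box_bump a b n x) \<longlonglongrightarrow> indicator (box a b) x"
proof (cases "x \<in> box a b")
  case False
  then show ?thesis by (simp add: box_bump_eq_0)
next
  case True
  have flat: "(\<lambda>n. flat 0 (real n * s)) \<longlonglongrightarrow> 1" if "0 < s" for s
  proof -
    have "(\<lambda>n. exp (- (1 / s * (1 / real n)))) \<longlonglongrightarrow> exp (- (1 / s * 0))"
      by (intro tendsto_intros lim_1_over_n)
    then have "(\<lambda>n. exp (- (1 / s * (1 / real n)))) \<longlonglongrightarrow> 1" by simp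
    then show ?thesis
      by (rule Lim_transform_eventually)
        (use that in \<open>auto intro: eventually_mono[OF eventually_gt_at_top[of 0]]
            simp: flat_def mult.commute\<close>)
  qed
  have "(\<lambda>n. \<Prod>i\<in>(UNIV::'a set). flat 0 (real n * (x $ i - a $ i)) * flat 0 (real n * (b $ i - x $ i)))
      \<longlonglongrightarrow> (\<Prod>i\<in>(UNIV::'a set). 1 * 1)"
    using True by (intro tendsto_intros flat) (auto simp: mem_box_cart)
  then show ?thesis using True by (simp add: box_bump_def algebra_simps)
qed

lemma box_bump_test_function:
  assumes "cbox a b \<subseteq> \<Omega>" shows "box_bump a b n \<in> test_functions \<Omega>"
proof -
  have "Ck m (box_bump a b n)" for m
    unfolding box_bump_def by (intro Ck_prod Ck_mult Ck_flat)
  moreover have "\<forall>x. x \<notin> cbox a b \<longrightarrow> box_bump a b n x = 0"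
    using box_subset_cbox box_bump_eq_0 by blast
  ultimately show ?thesis using assms
    unfolding test_functions_def mem_Collect_eq by (intro conjI allI exI[of _ "cbox a b"]) auto
qed

section \<open>Test functions and Lebesgue spaces\<close>

lemma powr_add_le:
  fixes x y p :: real
  assumes "0 \<le> p"
  shows "\<bar>x + y\<bar> powr p \<le> 2 powr p * (\<bar>x\<bar> powr p + \<bar>y\<bar> powr p)"
proof -
  have "\<bar>x + y\<bar> powr p \<le> (2 * max \<bar>x\<bar> \<bar>y\<bar>) powr p"
    using assms by (intro powr_mono2) auto
  also have "\<dots> = 2 powr p * max \<bar>x\<bar> \<bar>y\<bar> powr p" by (simp add: powr_mult)
  also have "max \<bar>x\<bar> \<bar>y\<bar> powr p \<le> \<bar>x\<bar> powr p + \<bar>y\<bar> powr p" by (auto simp: max_def)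
  finally show ?thesis by simp
qed

lemma Lp_space_measurable: "v \<in> Lp_space \<Omega> p \<Longrightarrow> v \<in> borel_measurable (lebesgue_on \<Omega>)"
  by (simp add: Lp_space_def)

lemma Lp_space_lincomb:
  assumes p: "0 \<le> p" and v: "v \<in> Lp_space \<Omega> p" and w: "w \<in> Lp_space \<Omega> p"
  shows "(\<lambda>x. a * v x + b * w x) \<in> Lp_space \<Omega> p"
proof -
  note [measurable] = v[THEN Lp_space_measurable] w[THEN Lp_space_measurable]
  have "integrable (lebesgue_on \<Omega>) (\<lambda>x. \<bar>a * v x + b * w x\<bar> powr p)"
  proof (rule Bochner_Integration.integrable_bound)
    show "integrable (lebesgue_on \<Omega>)
        (\<lambda>x. 2 powr p * (\<bar>a\<bar> powr p * \<bar>v x\<bar> powr p + \<bar>b\<bar> powr p * \<bar>w x\<bar> powr p))"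
      using v w by (auto simp: Lp_space_def)
    show "AE x in lebesgue_on \<Omega>. norm (\<bar>a * v x + b * w x\<bar> powr p)
        \<le> norm (2 powr p * (\<bar>a\<bar> powr p * \<bar>v x\<bar> powr p + \<bar>b\<bar> powr p * \<bar>w x\<bar> powr p))"
      using powr_add_le[OF p, of "a * v _" "b * w _"]
      by (intro AE_I2) (simp add: abs_mult powr_mult)
  qed measurable
  then show ?thesis by (simp add: Lp_space_def)
qed

lemma Lp_space_2_iff:
  "v \<in> Lp_space \<Omega> 2 \<longleftrightarrow>
     v \<in> borel_measurable (lebesgue_on \<Omega>) \<and> integrable (lebesgue_on \<Omega>) (\<lambda>x. (v x)\<^sup>2)"
  by (simp add: Lp_space_def powr_numeral)

lemma Lp_space_2_mult_integrable:
  assumes v: "v \<in> Lp_space \<Omega> 2" and w: "w \<in> Lp_space \<Omega> 2"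
  shows "integrable (lebesgue_on \<Omega>) (\<lambda>x. v x * w x)"
proof (rule Bochner_Integration.integrable_bound)
  note [measurable] = v[THEN Lp_space_measurable] w[THEN Lp_space_measurable]
  show "integrable (lebesgue_on \<Omega>) (\<lambda>x. (v x)\<^sup>2 + (w x)\<^sup>2)"
    using v w by (simp add: Lp_space_2_iff)
  show "(\<lambda>x. v x * w x) \<in> borel_measurable (lebesgue_on \<Omega>)" by measurable
  have "\<bar>v x * w x\<bar> \<le> (v x)\<^sup>2 + (w x)\<^sup>2" for x
    using sum_squares_bound[of "\<bar>v x\<bar>" "\<bar>w x\<bar>"] abs_ge_zero[of "v x * w x"]
    unfolding abs_mult power2_abs by linarith
  then show "AE x in lebesgue_on \<Omega>. norm (v x * w x) \<le> norm ((v x)\<^sup>2 + (w x)\<^sup>2)"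
    by (intro AE_I2) auto
qed

lemma compact_support_imp_bounded:
  fixes \<psi> :: "'a::metric_space \<Rightarrow> real"
  assumes "continuous_on UNIV \<psi>" "compact S" "\<And>x. x \<notin> S \<Longrightarrow> \<psi> x = 0"
  obtains B where "\<And>x. \<bar>\<psi> x\<bar> \<le> B"
proof -
  have "bounded (\<psi> ` S)"
    using assms by (meson compact_continuous_image compact_imp_bounded continuous_on_subset subset_UNIV)
  then obtain B where "\<And>x. x \<in> S \<Longrightarrow> \<bar>\<psi> x\<bar> \<le> B" by (auto simp: bounded_real)
  then have "\<bar>\<psi> x\<bar> \<le> max 0 B" for x using assms(3) by (cases "x \<in> S") force+
  then show thesis by (rule that)
qed

text \<open>Joins the gradient that \<open>Ck\<close> provides through \<open>GDERIV\<close> with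
  the \<open>frechet_derivative\<close> in \<open>is_weak_gradient\<close>, and records that one
  compact set carries both the function and its gradient.\<close>

lemma test_functionE:
  assumes "\<psi> \<in> test_functions \<Omega>"
  obtains G S where "\<And>x. GDERIV \<psi> x :> G x"
    and "\<And>x i. frechet_derivative \<psi> (at x) (axis i 1) = G x $ i"
    and "continuous_on UNIV \<psi>" and "\<And>i. continuous_on UNIV (\<lambda>x. G x $ i)"
    and "compact S" and "S \<subseteq> \<Omega>"
    and "\<And>x. x \<notin> S \<Longrightarrow> \<psi> x = 0" and "\<And>x. x \<notin> S \<Longrightarrow> G x = 0"
proof -
  obtain S where S: "compact S" "S \<subseteq> \<Omega>" "\<And>x. x \<notin> S \<Longrightarrow> \<psi> x = 0"
    using assms by (auto simp: test_functions_def)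
  have "Ck 1 \<psi>" using assms by (simp add: test_functions_def)
  then obtain G where G: "\<And>x. GDERIV \<psi> x :> G x" "\<And>i. continuous_on UNIV (\<lambda>x. G x $ i)"
    by auto
  \<comment> \<open>Off the closed set \<open>S\<close> the function vanishes on a neighbourhood, so
    its gradient there is 0 by uniqueness of the derivative.\<close>
  have G0: "G x = 0" if "x \<notin> S" for x
  proof -
    have "\<forall>\<^sub>F y in nhds x. y \<in> - S"
      using S(1) that by (intro eventually_nhds_in_open) (auto intro: compact_imp_closed)
    then have "\<forall>\<^sub>F y in nhds x. \<psi> y = 0" by eventually_elim (use S in auto)
    then have "(\<psi> has_derivative (\<lambda>h. 0)) (at x)"
      using S that
      by (intro has_derivative_transform_eventually[OF has_derivative_const[of 0]])
        (auto simp: eventually_at_filter elim!: eventually_mono)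
    then have "(\<lambda>h. h \<bullet> G x) = (\<lambda>h. 0)"
      using G(1) has_derivative_unique by (metis gderiv_def)
    then have "G x \<bullet> G x = 0" by metis
    then show ?thesis by simp
  qed
  show thesis
  proof (rule that[OF G(1) _ _ G(2) S G0])
    show "frechet_derivative \<psi> (at x) (axis i 1) = G x $ i" for x i
    proof -
      have "frechet_derivative \<psi> (at x) = (\<lambda>h. h \<bullet> G x)"
        using G(1)[of x] unfolding gderiv_def by (rule frechet_derivative_at[symmetric])
      then show ?thesis by (simp add: inner_axis')
    qed
    show "continuous_on UNIV \<psi>" using \<open>Ck 1 \<psi>\<close> Ck_imp_continuous by blast
  qed
qed

lemma test_function_bounded:
  assumes "\<psi> \<in> test_functions \<Omega>"
  obtains B where "\<And>x. \<bar>\<psi> x\<bar> \<le> B"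
proof -
  obtain S where "continuous_on UNIV \<psi>" "compact S" "\<And>x. x \<notin> S \<Longrightarrow> \<psi> x = 0"
    using test_functionE[OF assms] by metis
  then show thesis using compact_support_imp_bounded[of \<psi> S] that by metis
qed

lemma test_function_deriv_bounded:
  assumes "\<psi> \<in> test_functions \<Omega>"
  obtains B where "\<And>x. \<bar>frechet_derivative \<psi> (at x) (axis i 1)\<bar> \<le> B"
proof -
  obtain G S where "\<And>x i. frechet_derivative \<psi> (at x) (axis i 1) = G x $ i"
    "\<And>i. continuous_on UNIV (\<lambda>x. G x $ i)" "compact S" "\<And>x. x \<notin> S \<Longrightarrow> G x = 0"
    using test_functionE[OF assms] by metis
  then show thesis
    using compact_support_imp_bounded[of "\<lambda>x. G x $ i" S] that by (metis zero_index)
qed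

lemma continuous_imp_measurable_lebesgue_on:
  fixes f :: "real^'d \<Rightarrow> real"
  assumes "continuous_on UNIV f" shows "f \<in> borel_measurable (lebesgue_on \<Omega>)"
proof -
  have "f \<in> borel_measurable lebesgue"
    using assms by (intro measurable_completion) (simp add: borel_measurable_continuous_onI)
  then show ?thesis by (rule measurable_restrict_space1)
qed

lemma test_function_measurable:
  assumes "\<psi> \<in> test_functions \<Omega>"
  shows "\<psi> \<in> borel_measurable (lebesgue_on \<Omega>')"
    and "(\<lambda>x. frechet_derivative \<psi> (at x) (axis i 1)) \<in> borel_measurable (lebesgue_on \<Omega>')"
proof -
  obtain G where "\<And>x i. frechet_derivative \<psi> (at x) (axis i 1) = G x $ i"
    "continuous_on UNIV \<psi>" "\<And>i. continuous_on UNIV (\<lambda>x. G x $ i)"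
    using test_functionE[OF assms] by metis
  then show "\<psi> \<in> borel_measurable (lebesgue_on \<Omega>')"
    "(\<lambda>x. frechet_derivative \<psi> (at x) (axis i 1)) \<in> borel_measurable (lebesgue_on \<Omega>')"
    by (simp_all add: continuous_imp_measurable_lebesgue_on)
qed

lemma test_functions_lincomb:
  assumes "\<psi> \<in> test_functions \<Omega>" "\<eta> \<in> test_functions \<Omega>"
  shows "(\<lambda>x. a * \<psi> x + b * \<eta> x) \<in> test_functions \<Omega>"
proof -
  obtain S T where S: "compact S" "S \<subseteq> \<Omega>" "\<And>x. x \<notin> S \<Longrightarrow> \<psi> x = 0"
    and T: "compact T" "T \<subseteq> \<Omega>" "\<And>x. x \<notin> T \<Longrightarrow> \<eta> x = 0"
    using assms by (auto simp: test_functions_def)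
  have "compact (S \<union> T) \<and> S \<union> T \<subseteq> \<Omega> \<and> (\<forall>x. x \<notin> S \<union> T \<longrightarrow> a * \<psi> x + b * \<eta> x = 0)"
    using S T by (auto intro: compact_Un)
  moreover have "\<forall>n. Ck n (\<lambda>x. a * \<psi> x + b * \<eta> x)"
    using assms by (auto simp: test_functions_def intro: Ck_lincomb)
  ultimately show ?thesis unfolding test_functions_def mem_Collect_eq by (intro conjI exI[of _ "S \<union> T"]) auto
qed

lemma zero_in_test_functions: "(\<lambda>x. 0) \<in> test_functions \<Omega>"
  unfolding test_functions_def by (auto intro!: Ck_const exI[of _ "{}"])

text \<open>The integral of the difference quotient vanishes by translation invariance.\<close>

lemma integral_partial_derivative_compact_support:
  fixes F :: "real^'d \<Rightarrow> real"
  assumes deriv: "\<And>x. GDERIV F x :> G x" and contG: "continuous_on UNIV (\<lambda>x. G x $ i)"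
    and S: "compact S" "\<And>x. x \<notin> S \<Longrightarrow> F x = 0" "\<And>x. x \<notin> S \<Longrightarrow> G x = 0"
  shows "integrable lborel (\<lambda>x. G x $ i)" and "(LINT x|lborel. G x $ i) = 0"
proof -
  let ?e = "axis i 1 :: real^'d"
  define h where "h n = 1 / real (Suc n)" for n
  have h: "0 < h n" "h n \<le> 1" for n by (auto simp: h_def)
  define q where "q n x = (F (x + h n *\<^sub>R ?e) - F x) / h n" for n x
  obtain B where B: "\<And>x. \<bar>G x $ i\<bar> \<le> B"
    using compact_support_imp_bounded[OF contG S(1)] S(3) by auto
  obtain R where "\<forall>x\<in>S. norm x \<le> R"
    using compact_imp_bounded[OF S(1)] by (auto simp: bounded_iff)
  then have R: "S \<subseteq> cball 0 R" by auto
  have contF: "continuous_on UNIV F"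
    using deriv unfolding gderiv_def
    by (intro continuous_at_imp_continuous_on ballI has_derivative_continuous)
  have [measurable]: "F \<in> borel_measurable borel" "(\<lambda>x. G x $ i) \<in> borel_measurable borel"
    using contF contG by (auto intro: borel_measurable_continuous_onI)
  have [measurable]: "q n \<in> borel_measurable borel" for n
    unfolding q_def by measurable
  have line: "((\<lambda>t. F (x + t *\<^sub>R ?e)) has_real_derivative G (x + t *\<^sub>R ?e) $ i) (at t)" for x t
  proof -
    have "((\<lambda>t. F (x + t *\<^sub>R ?e)) has_derivative (\<lambda>s. (s *\<^sub>R ?e) \<bullet> G (x + t *\<^sub>R ?e))) (at t)"
      using deriv[of "x + t *\<^sub>R ?e"] unfolding gderiv_def
      by (intro has_derivative_compose[where g = F and f = "\<lambda>t. x + t *\<^sub>R ?e"])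
        (auto intro!: derivative_eq_intros)
    then show ?thesis
      by (simp add: has_field_derivative_def inner_axis' mult.commute[of _ "G _ $ i"])
  qed
  \<comment> \<open>The majorant for dominated convergence: the mean value theorem bounds the
    quotient by \<open>B\<close>, and since the steps \<open>h n\<close> are at most 1, both
    evaluation points lie off \<open>S\<close> once \<open>x\<close> is outside the ball of radius
    \<open>R + 1\<close>.\<close>
  have q_bound: "\<bar>q n x\<bar> \<le> B * indicator (cball 0 (R + 1)) x" for n x
  proof (cases "x \<in> cball 0 (R + 1)")
    case True
    obtain t where "F (x + h n *\<^sub>R ?e) - F x = h n * G (x + t *\<^sub>R ?e) $ i"
      using MVT2[OF h(1)[of n], of "\<lambda>t. F (x + t *\<^sub>R ?e)" "\<lambda>t. G (x + t *\<^sub>R ?e) $ i"] line by auto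
    then have "q n x = G (x + t *\<^sub>R ?e) $ i" using h(1)[of n] by (simp add: q_def)
    then show ?thesis using B True by simp
  next
    case False
    have "norm x \<le> norm (x + h n *\<^sub>R ?e) + norm (h n *\<^sub>R ?e)"
      using norm_triangle_ineq4[of "x + h n *\<^sub>R ?e" "h n *\<^sub>R ?e"] by simp
    also have "\<dots> \<le> norm (x + h n *\<^sub>R ?e) + 1" using h[of n] by (simp add: norm_axis_1)
    finally have "x \<notin> S" "x + h n *\<^sub>R ?e \<notin> S" using False R by auto
    then show ?thesis using False S(2) by (simp add: q_def)
  qed
  have q_lim: "(\<lambda>n. q n x) \<longlonglongrightarrow> G x $ i" for x
  proof -
    have "((\<lambda>k. (F (x + k *\<^sub>R ?e) - F x) / k) \<longlongrightarrow> G x $ i) (at 0)"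
      using line[of x 0] by (simp add: DERIV_def)
    moreover have "filterlim h (at 0) sequentially"
      using LIMSEQ_Suc[OF lim_1_over_n] h(1) unfolding filterlim_at h_def
      by (auto intro!: always_eventually)
    ultimately show ?thesis unfolding q_def by (rule filterlim_compose)
  qed
  have dom: "integrable lborel (\<lambda>x::real^'d. B * indicator (cball 0 (R + 1)) x)"
    using emeasure_lborel_cball_finite[of "0::real^'d" "R + 1"]
    by (intro integrable_mult_right integrable_real_indicator) auto
  show "integrable lborel (\<lambda>x. G x $ i)"
    by (rule integrable_dominated_convergence[OF _ _ dom, where s = q])
      (use q_lim q_bound in auto)
  have "(\<lambda>n. LINT x|lborel. q n x) \<longlonglongrightarrow> (LINT x|lborel. G x $ i)"
    by (rule integral_dominated_convergence[OF _ _ dom])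
      (use q_lim q_bound in auto)
  moreover have "(LINT x|lborel. q n x) = 0" for n
  proof -
    obtain BF where "\<And>x. \<bar>F x\<bar> \<le> BF" using compact_support_imp_bounded[OF contF S(1,2)] by auto
    then have intF: "integrable lborel F"
      using emeasure_bounded_finite[OF compact_imp_bounded[OF S(1)]] S by (intro integrableI_bounded_set[of S _ _ BF])
        (auto simp: compact_imp_closed)
    have eq: "F (x + h n *\<^sub>R ?e) = F (h n *\<^sub>R ?e + x)" for x by (simp add: add.commute)
    have "integrable lborel (\<lambda>x. F (x + h n *\<^sub>R ?e))"
      using integrable_distr[of "(+) (h n *\<^sub>R ?e)" lborel borel F] intF
      by (simp add: lborel_distr_plus eq)
    moreover have "(LINT x|lborel. F (x + h n *\<^sub>R ?e)) = (LINT x|lborel. F x)"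
      using integral_distr[of "(+) (h n *\<^sub>R ?e)" lborel borel F]
      by (simp add: lborel_distr_plus eq)
    ultimately show ?thesis using intF by (simp add: q_def)
  qed
  ultimately show "(LINT x|lborel. G x $ i) = 0" by (simp add: LIMSEQ_const_iff)
qed

section \<open>Weak gradients\<close>

lemma integrable_mult_bounded:
  fixes f g :: "'a \<Rightarrow> real"
  assumes f: "integrable M f" and [measurable]: "g \<in> borel_measurable M" and B: "\<And>x. \<bar>g x\<bar> \<le> B"
  shows "integrable M (\<lambda>x. f x * g x)"
proof (rule Bochner_Integration.integrable_bound)
  show "integrable M (\<lambda>x. B * f x)" using f by simp
  have [measurable]: "f \<in> borel_measurable M" using f by simp
  show "(\<lambda>x. f x * g x) \<in> borel_measurable M" by measurable
  have "\<bar>f x * g x\<bar> \<le> \<bar>B * f x\<bar>" for x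
    using mult_left_mono[OF order_trans[OF B[of x] abs_ge_self[of B]], of "\<bar>f x\<bar>"]
    by (simp add: abs_mult mult.commute)
  then show "AE x in M. norm (f x * g x) \<le> norm (B * f x)" by (intro AE_I2) simp
qed

text \<open>Lebesgue differentiation over cubes: at almost every point, \<open>g\<close> extended by
  0 is the limit of its means over cubes with a corner at that point, and the small ones lie in
  \<Omega>, where the means vanish.\<close>

lemma box_integral_eq_0_imp_AE_0:
  fixes g :: "real^'d \<Rightarrow> real"
  assumes "open \<Omega>" and g: "integrable (lebesgue_on \<Omega>) g"
    and zero: "\<And>a b. cbox a b \<subseteq> \<Omega> \<Longrightarrow> (LINT x|lebesgue_on \<Omega>. g x * indicator (box a b) x) = 0"
  shows "AE x in lebesgue_on \<Omega>. g x = 0"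
proof -
  have S: "\<Omega> \<in> sets lebesgue" using assms(1) by (simp add: borel_open)
  define f where "f x = (if x \<in> \<Omega> then g x else 0)" for x
  have f: "integrable lebesgue f"
    using g S unfolding f_def by (simp add: Lebesgue_Measure.integrable_restrict_UNIV)
  have f_set: "set_integrable lebesgue A f" if "A \<in> sets lebesgue" for A
    using f that unfolding set_integrable_def by (intro integrable_mult_indicator)
  have "f integrable_on cbox a b" for a b
    by (intro set_lebesgue_integral_eq_integral(1) f_set) simp
  then obtain N where N: "negligible N"
    "\<And>x e. \<lbrakk>x \<notin> N; 0 < e\<rbrakk> \<Longrightarrow> \<exists>d>0. \<forall>h. 0 < h \<and> h < d \<longrightarrow>
       norm (integral (cbox x (x + h *\<^sub>R One)) f /\<^sub>R h ^ DIM(real^'d) - f x) < e"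
    using integrable_ccontinuous_explicit by metis
  have box0: "integral (cbox a b) f = 0" if "cbox a b \<subseteq> \<Omega>" for a b
  proof -
    have "integral (cbox a b) f = integral (box a b) f" by (simp add: integral_open_interval)
    also have "\<dots> = (LINT x:box a b|lebesgue. f x)"
      by (rule set_lebesgue_integral_eq_integral(2)[symmetric], rule f_set) simp
    also have "\<dots> = (LINT x|lebesgue. indicator \<Omega> x *\<^sub>R (g x * indicator (box a b) x))"
      unfolding set_lebesgue_integral_def f_def
      by (intro Bochner_Integration.integral_cong) (auto simp: indicator_def)
    also have "\<dots> = (LINT x|lebesgue_on \<Omega>. g x * indicator (box a b) x)"
      using S by (intro integral_restrict_space[symmetric]) simp
    finally show ?thesis using zero[OF that] by simp
  qed
  have "g x = 0" if x: "x \<in> \<Omega>" "x \<notin> N" for x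
  proof -
    obtain r where r: "0 < r" "cball x r \<subseteq> \<Omega>"
      using \<open>open \<Omega>\<close> x(1) open_contains_cball by blast
    have "\<bar>f x\<bar> < e" if e: "0 < e" for e
    proof -
      obtain d where d: "0 < d" "\<And>h. 0 < h \<Longrightarrow> h < d \<Longrightarrow>
          norm (integral (cbox x (x + h *\<^sub>R One)) f /\<^sub>R h ^ DIM(real^'d) - f x) < e"
        using N(2)[OF x(2) e] by blast
      \<comment> \<open>The side stays below the differentiation radius \<open>d\<close> and lets
        the cube fit into \<open>cball x r\<close>. The dimension enters through the bound of the
        Euclidean norm by the l1 norm.\<close>
      define h where "h = min (d / 2) (r / DIM(real^'d))"
      have h: "0 < h" "h < d" "h * DIM(real^'d) \<le> r"
        using d r by (auto simp: h_def min_def field_simps)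
      have "cbox x (x + h *\<^sub>R One) \<subseteq> cball x r"
      proof
        fix y assume y: "y \<in> cbox x (x + h *\<^sub>R One)"
        have "norm (y - x) \<le> (\<Sum>b\<in>Basis. \<bar>(y - x) \<bullet> b\<bar>)" by (rule norm_le_l1)
        also have "\<dots> \<le> (\<Sum>b\<in>(Basis::(real^'d) set). h)"
          using y by (intro sum_mono) (auto simp: mem_box inner_diff_left inner_add_left)
        also have "\<dots> \<le> r" using h(3) by (simp add: mult.commute)
        finally show "y \<in> cball x r" by (simp add: dist_norm norm_minus_commute)
      qed
      with r have "integral (cbox x (x + h *\<^sub>R One)) f = 0" by (intro box0) auto
      with d(2)[OF h(1,2)] show ?thesis by simp
    qed
    then have "f x = 0" by (metis abs_le_zero_iff not_less less_irrefl zero_less_abs_iff)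
    then show ?thesis using x by (simp add: f_def)
  qed
  then have "{x. \<not> (x \<in> \<Omega> \<longrightarrow> g x = 0)} \<subseteq> N" by auto
  then have "AE x in lebesgue. x \<in> \<Omega> \<longrightarrow> g x = 0"
    using N(1) by (intro AE_I') (auto simp: negligible_iff_null_sets)
  then show ?thesis using S by (subst AE_restrict_space_iff) auto
qed

text \<open>The values of \<open>box_bump\<close> lie between 0 and 1, so |g| dominates the
  integrands, and the limit turns test functions into indicators of boxes.\<close>

lemma fundamental_lemma_calculus_of_variations:
  fixes g :: "real^'d \<Rightarrow> real"
  assumes "open \<Omega>" and g: "integrable (lebesgue_on \<Omega>) g"
    and zero: "\<And>\<psi>. \<psi> \<in> test_functions \<Omega> \<Longrightarrow> (LINT x|lebesgue_on \<Omega>. g x * \<psi> x) = 0"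
  shows "AE x in lebesgue_on \<Omega>. g x = 0"
proof (rule box_integral_eq_0_imp_AE_0[OF assms(1,2)])
  fix a b assume ab: "cbox a b \<subseteq> \<Omega>"
  note test = box_bump_test_function[OF ab]
  have [measurable]: "box_bump a b n \<in> borel_measurable (lebesgue_on \<Omega>)" for n
    using test by (rule test_function_measurable)
  have [measurable]: "g \<in> borel_measurable (lebesgue_on \<Omega>)" using g by simp
  have lim: "(\<lambda>n. g x * box_bump a b n x) \<longlonglongrightarrow> g x * indicator (box a b) x" for x
    by (intro tendsto_intros box_bump_tendsto)
  have bound: "norm (g x * box_bump a b n x) \<le> \<bar>g x\<bar>" for n x
    using box_bump_bounds[of a b n x] mult_left_mono[of "box_bump a b n x" 1 "\<bar>g x\<bar>"]
    by (simp add: abs_mult)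
  have "(\<lambda>n. LINT x|lebesgue_on \<Omega>. g x * box_bump a b n x)
      \<longlonglongrightarrow> (LINT x|lebesgue_on \<Omega>. g x * indicator (box a b) x)"
  proof (rule integral_dominated_convergence[where w = "\<lambda>x. \<bar>g x\<bar>"])
    show "(\<lambda>x. g x * indicator (box a b) x) \<in> borel_measurable (lebesgue_on \<Omega>)"
      by (rule borel_measurable_LIMSEQ_real[OF lim]) measurable
  qed (use g lim bound in auto)
  then show "(LINT x|lebesgue_on \<Omega>. g x * indicator (box a b) x) = 0"
    by (simp add: zero[OF test] LIMSEQ_const_iff)
qed

section \<open>Weak gradients and the space \<open>H10\<close> on a bounded open set\<close>

context
  fixes \<Omega> :: "(real^'d) set"
  assumes open_dom: "open \<Omega>" and bounded_dom: "bounded \<Omega>"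
begin

lemma dom_lebesgue: "\<Omega> \<in> sets lebesgue"
  using open_dom by (simp add: borel_open)

lemma finite_measure_dom: "finite_measure (lebesgue_on \<Omega>)"
  by (intro finite_measure_lebesgue_on lmeasurable_open open_dom bounded_dom)

lemma bounded_in_Lp_space:
  assumes p: "0 \<le> p" and [measurable]: "v \<in> borel_measurable (lebesgue_on \<Omega>)"
    and B: "\<And>x. x \<in> \<Omega> \<Longrightarrow> \<bar>v x\<bar> \<le> B"
  shows "v \<in> Lp_space \<Omega> p"
proof -
  interpret finite_measure "lebesgue_on \<Omega>" by (rule finite_measure_dom)
  have "integrable (lebesgue_on \<Omega>) (\<lambda>x. \<bar>v x\<bar> powr p)"
  proof (rule integrable_const_bound[where B = "B powr p"])
    show "AE x in lebesgue_on \<Omega>. norm (\<bar>v x\<bar> powr p) \<le> B powr p"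
      using p B by (intro AE_I2) (auto intro!: powr_mono2)
  qed measurable
  then show ?thesis by (simp add: Lp_space_def)
qed

lemma Lp_space_2_integrable:
  assumes "v \<in> Lp_space \<Omega> 2" shows "integrable (lebesgue_on \<Omega>) v"
  using Lp_space_2_mult_integrable[OF assms bounded_in_Lp_space[of 2 "\<lambda>_. 1" 1]] by simp

lemma test_functions_subset_Lp_space_2: "test_functions \<Omega> \<subseteq> Lp_space \<Omega> 2"
proof
  fix \<psi> assume \<psi>: "\<psi> \<in> test_functions \<Omega>"
  obtain B where "\<And>x. \<bar>\<psi> x\<bar> \<le> B" using test_function_bounded[OF \<psi>] by metis
  then show "\<psi> \<in> Lp_space \<Omega> 2"
    using test_function_measurable(1)[OF \<psi>] by (intro bounded_in_Lp_space[of 2 \<psi> B]) auto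
qed

lemma integrable_mult_test_function:
  assumes "v \<in> Lp_space \<Omega> 2" and \<psi>: "\<psi> \<in> test_functions \<Omega>"
  shows "integrable (lebesgue_on \<Omega>) (\<lambda>x. v x * \<psi> x)"
    and "integrable (lebesgue_on \<Omega>) (\<lambda>x. v x * frechet_derivative \<psi> (at x) (axis i 1))"
proof -
  note v = Lp_space_2_integrable[OF assms(1)]
  show "integrable (lebesgue_on \<Omega>) (\<lambda>x. v x * \<psi> x)"
    by (rule test_function_bounded[OF \<psi>])
      (rule integrable_mult_bounded[OF v test_function_measurable(1)[OF \<psi>]])
  show "integrable (lebesgue_on \<Omega>) (\<lambda>x. v x * frechet_derivative \<psi> (at x) (axis i 1))"
    by (rule test_function_deriv_bounded[OF \<psi>])
      (rule integrable_mult_bounded[OF v test_function_measurable(2)[OF \<psi>]])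
qed

lemma is_weak_gradient_Lp:
  "is_weak_gradient \<Omega> v G \<Longrightarrow> (\<lambda>x. G x $ i) \<in> Lp_space \<Omega> 2"
  by (simp add: is_weak_gradient_def)

lemma is_weak_gradient_lincomb:
  assumes v: "v \<in> Lp_space \<Omega> 2" "is_weak_gradient \<Omega> v G"
    and w: "w \<in> Lp_space \<Omega> 2" "is_weak_gradient \<Omega> w H"
  shows "is_weak_gradient \<Omega> (\<lambda>x. a * v x + b * w x) (\<lambda>x. a *\<^sub>R G x + b *\<^sub>R H x)"
proof -
  note GH = v(2)[THEN is_weak_gradient_Lp] w(2)[THEN is_weak_gradient_Lp]
  have "(LINT x|lebesgue_on \<Omega>. (a * v x + b * w x) * frechet_derivative \<psi> (at x) (axis i 1)) =
        - (LINT x|lebesgue_on \<Omega>. (a *\<^sub>R G x + b *\<^sub>R H x) $ i * \<psi> x)"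
    if \<psi>: "\<psi> \<in> test_functions \<Omega>" for \<psi> i
  proof -
    have "(LINT x|lebesgue_on \<Omega>. (a * v x + b * w x) * frechet_derivative \<psi> (at x) (axis i 1))
        = a * (LINT x|lebesgue_on \<Omega>. v x * frechet_derivative \<psi> (at x) (axis i 1))
          + b * (LINT x|lebesgue_on \<Omega>. w x * frechet_derivative \<psi> (at x) (axis i 1))"
      using integrable_mult_test_function(2)[OF v(1) \<psi>] integrable_mult_test_function(2)[OF w(1) \<psi>]
      by (simp add: distrib_right mult.assoc)
    also have "\<dots> = - (a * (LINT x|lebesgue_on \<Omega>. G x $ i * \<psi> x)
                     + b * (LINT x|lebesgue_on \<Omega>. H x $ i * \<psi> x))"
      using v(2) w(2) \<psi> by (simp add: is_weak_gradient_def)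
    also have "\<dots> = - (LINT x|lebesgue_on \<Omega>. (a *\<^sub>R G x + b *\<^sub>R H x) $ i * \<psi> x)"
      using integrable_mult_test_function(1)[OF GH(1) \<psi>] integrable_mult_test_function(1)[OF GH(2) \<psi>]
      by (simp add: distrib_right mult.assoc)
    finally show ?thesis .
  qed
  moreover have "(\<lambda>x. (a *\<^sub>R G x + b *\<^sub>R H x) $ i) \<in> Lp_space \<Omega> 2" for i
    using Lp_space_lincomb[OF _ GH] by simp
  ultimately show ?thesis by (simp add: is_weak_gradient_def)
qed

text \<open>This makes the arbitrary choice in \<open>wgrad\<close> harmless. The fundamental lemma
  is applied to each of the finitely many components of \<open>G - H\<close>.\<close>

lemma is_weak_gradient_unique:
  assumes G: "is_weak_gradient \<Omega> v G" and H: "is_weak_gradient \<Omega> v H"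
  shows "AE x in lebesgue_on \<Omega>. G x = H x"
proof -
  note GH = G[THEN is_weak_gradient_Lp] H[THEN is_weak_gradient_Lp]
  have "AE x in lebesgue_on \<Omega>. G x $ i - H x $ i = 0" for i
  proof (rule fundamental_lemma_calculus_of_variations[OF open_dom])
    show "integrable (lebesgue_on \<Omega>) (\<lambda>x. G x $ i - H x $ i)"
      using GH by (intro Bochner_Integration.integrable_diff Lp_space_2_integrable)
    fix \<psi> :: "real^'d \<Rightarrow> real" assume \<psi>: "\<psi> \<in> test_functions \<Omega>"
    have "(LINT x|lebesgue_on \<Omega>. G x $ i * \<psi> x) = (LINT x|lebesgue_on \<Omega>. H x $ i * \<psi> x)"
      using G H \<psi> by (simp add: is_weak_gradient_def)
    then show "(LINT x|lebesgue_on \<Omega>. (G x $ i - H x $ i) * \<psi> x) = 0"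
      using integrable_mult_test_function(1)[OF GH(1) \<psi>] integrable_mult_test_function(1)[OF GH(2) \<psi>]
      by (simp add: left_diff_distrib)
  qed
  then have "AE x in lebesgue_on \<Omega>. \<forall>i\<in>UNIV. G x $ i - H x $ i = 0"
    by (intro AE_finite_allI) auto
  then show ?thesis by eventually_elim (simp add: vec_eq_iff)
qed

text \<open>Integration by parts without boundary term: the product of two test functions has
  compact support, so its partial derivatives integrate to 0.\<close>

lemma test_function_weak_gradient:
  assumes \<psi>: "\<psi> \<in> test_functions \<Omega>"
  shows "\<exists>G. is_weak_gradient \<Omega> \<psi> G"
proof -
  obtain G S where G: "\<And>x. GDERIV \<psi> x :> G x" "\<And>x i. frechet_derivative \<psi> (at x) (axis i 1) = G x $ i"
    "continuous_on UNIV \<psi>" "\<And>i. continuous_on UNIV (\<lambda>x. G x $ i)"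
    "compact S" "S \<subseteq> \<Omega>" "\<And>x. x \<notin> S \<Longrightarrow> \<psi> x = 0" "\<And>x. x \<notin> S \<Longrightarrow> G x = 0"
    by (rule test_functionE[OF \<psi>]) (rule that)
  have \<psi>_L2: "\<psi> \<in> Lp_space \<Omega> 2"
    using \<psi> test_functions_subset_Lp_space_2 by blast
  have G_L2: "(\<lambda>x. G x $ i) \<in> Lp_space \<Omega> 2" for i
  proof -
    obtain B where "\<And>x. \<bar>frechet_derivative \<psi> (at x) (axis i 1)\<bar> \<le> B"
      using test_function_deriv_bounded[OF \<psi>] by metis
    then show ?thesis
      using test_function_measurable(2)[OF \<psi>, of i \<Omega>] G(2)
      by (intro bounded_in_Lp_space[of 2 _ B]) auto
  qed
  have "(LINT x|lebesgue_on \<Omega>. \<psi> x * frechet_derivative \<eta> (at x) (axis i 1)) =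
        - (LINT x|lebesgue_on \<Omega>. G x $ i * \<eta> x)" if \<eta>: "\<eta> \<in> test_functions \<Omega>" for \<eta> i
  proof -
    obtain H where H: "\<And>x. GDERIV \<eta> x :> H x" "\<And>x i. frechet_derivative \<eta> (at x) (axis i 1) = H x $ i"
      "continuous_on UNIV \<eta>" "\<And>i. continuous_on UNIV (\<lambda>x. H x $ i)"
      using test_functionE[OF \<eta>] by metis
    have out: "\<psi> x = 0 \<and> G x = 0" if "x \<notin> \<Omega>" for x using G(6-8) that by blast
    \<comment> \<open>The gradient of the product. It vanishes outside \<Omega>, so its integral
      over \<Omega> is that over the whole space.\<close>
    define K where "K x = \<psi> x *\<^sub>R H x + \<eta> x *\<^sub>R G x" for x
    have K_cont: "continuous_on UNIV (\<lambda>x. K x $ i)"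
      unfolding K_def vector_add_component vector_scaleR_component real_scaleR_def
      by (intro continuous_intros G(3,4) H(3,4))
    have "(LINT x|lborel. K x $ i) = 0"
      using G(5,7,8) unfolding K_def
      by (intro integral_partial_derivative_compact_support(2)[of "\<lambda>x. \<psi> x * \<eta> x" _ _ S]
          GDERIV_mult G(1) H(1) K_cont[unfolded K_def]) auto
    moreover have "(LINT x|lborel. K x $ i) = (LINT x|lebesgue. K x $ i)"
      using K_cont by (intro integral_completion[symmetric]) (simp add: borel_measurable_continuous_onI)
    moreover have "(LINT x|lebesgue. K x $ i) = (LINT x|lebesgue. indicator \<Omega> x *\<^sub>R (K x $ i))"
      using out by (intro Bochner_Integration.integral_cong) (auto simp: K_def indicator_def)
    moreover have "\<dots> = (LINT x|lebesgue_on \<Omega>. K x $ i)"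
      using dom_lebesgue by (intro integral_restrict_space[symmetric]) simp
    ultimately have "(LINT x|lebesgue_on \<Omega>. \<psi> x * H x $ i + G x $ i * \<eta> x) = 0"
      by (simp add: K_def mult.commute)
    then show ?thesis
      using integrable_mult_test_function(2)[OF \<psi>_L2 \<eta>, of i]
        integrable_mult_test_function(1)[OF G_L2[of i] \<eta>]
      by (simp add: H(2))
  qed
  with G_L2 show ?thesis by (auto simp: is_weak_gradient_def)
qed

lemma test_functions_subset_H1: "test_functions \<Omega> \<subseteq> H1 \<Omega>"
  using test_functions_subset_Lp_space_2 test_function_weak_gradient by (auto simp: H1_def)

lemma H1_weak_gradient: "v \<in> H1 \<Omega> \<Longrightarrow> is_weak_gradient \<Omega> v (wgrad \<Omega> v)"
  by (simp add: H1_def wgrad_def) (metis someI_ex)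

lemma wgrad_Lp: "v \<in> H1 \<Omega> \<Longrightarrow> (\<lambda>x. wgrad \<Omega> v x $ i) \<in> Lp_space \<Omega> 2"
  by (rule is_weak_gradient_Lp[OF H1_weak_gradient])

lemma H1_lincomb:
  assumes "v \<in> H1 \<Omega>" "w \<in> H1 \<Omega>" shows "(\<lambda>x. a * v x + b * w x) \<in> H1 \<Omega>"
  using assms is_weak_gradient_lincomb[of v _ w] Lp_space_lincomb[of 2 v \<Omega> w]
  unfolding H1_def by simp blast

lemma wgrad_lincomb:
  assumes "v \<in> H1 \<Omega>" "w \<in> H1 \<Omega>"
  shows "AE x in lebesgue_on \<Omega>.
           wgrad \<Omega> (\<lambda>x. a * v x + b * w x) x = a *\<^sub>R wgrad \<Omega> v x + b *\<^sub>R wgrad \<Omega> w x"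
  using assms H1_lincomb[OF assms]
  by (intro is_weak_gradient_unique[OF H1_weak_gradient] is_weak_gradient_lincomb H1_weak_gradient)
    (auto simp: H1_def)

lemma H1_diff: "v \<in> H1 \<Omega> \<Longrightarrow> w \<in> H1 \<Omega> \<Longrightarrow> (\<lambda>x. v x - w x) \<in> H1 \<Omega>"
  using H1_lincomb[of v w 1 "-1"] by simp

lemma wgrad_diff:
  "v \<in> H1 \<Omega> \<Longrightarrow> w \<in> H1 \<Omega> \<Longrightarrow>
     AE x in lebesgue_on \<Omega>. wgrad \<Omega> (\<lambda>x. v x - w x) x = wgrad \<Omega> v x - wgrad \<Omega> w x"
  using wgrad_lincomb[of v w 1 "-1"] by simp

text \<open>The parallelogram law, with its factor 2, stands in for Minkowski's inequality. This
  suffices for approximation arguments.\<close>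

lemma H1_norm_lincomb:
  assumes v: "v \<in> H1 \<Omega>" and w: "w \<in> H1 \<Omega>"
  shows "(H1_norm \<Omega> (\<lambda>x. a * v x + b * w x))\<^sup>2 \<le> 2 * a\<^sup>2 * (H1_norm \<Omega> v)\<^sup>2 + 2 * b\<^sup>2 * (H1_norm \<Omega> w)\<^sup>2"
proof -
  have H1_norm_sq: "(H1_norm \<Omega> z)\<^sup>2 = (LINT x|lebesgue_on \<Omega>. (z x)\<^sup>2) +
      (LINT x|lebesgue_on \<Omega>. (norm (wgrad \<Omega> z x))\<^sup>2)" for z
    by (simp add: H1_norm_def)
  have int: "integrable (lebesgue_on \<Omega>) (\<lambda>x. (z x)\<^sup>2)"
    "integrable (lebesgue_on \<Omega>) (\<lambda>x. (norm (wgrad \<Omega> z x))\<^sup>2)" if "z \<in> H1 \<Omega>" for z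
  proof -
    show "integrable (lebesgue_on \<Omega>) (\<lambda>x. (z x)\<^sup>2)"
      using that by (auto simp: H1_def Lp_space_2_iff)
    show "integrable (lebesgue_on \<Omega>) (\<lambda>x. (norm (wgrad \<Omega> z x))\<^sup>2)"
      unfolding power2_norm_eq_inner inner_vec_def inner_real_def
      using wgrad_Lp[OF that]
      by (intro Bochner_Integration.integrable_sum Lp_space_2_mult_integrable)
  qed
  define z where "z = (\<lambda>x. a * v x + b * w x)"
  have z: "z \<in> H1 \<Omega>" unfolding z_def using v w by (rule H1_lincomb)
  \<comment> \<open>Stated for any inner product space, to serve both the real values and the vector
    gradients.\<close>
  have sq: "(norm (a *\<^sub>R y + b *\<^sub>R y'))\<^sup>2 \<le> 2 * a\<^sup>2 * (norm y)\<^sup>2 + 2 * b\<^sup>2 * (norm y')\<^sup>2"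
    for y y' :: "'x::real_inner"
  proof -
    have "(norm (x + x'))\<^sup>2 + (norm (x - x'))\<^sup>2 = 2 * (norm x)\<^sup>2 + 2 * (norm x')\<^sup>2" for x x' :: 'x
      unfolding power2_norm_eq_inner
      by (simp add: inner_add_left inner_add_right inner_diff_left inner_diff_right)
    from this[of "a *\<^sub>R y" "b *\<^sub>R y'"]
    have "(norm (a *\<^sub>R y + b *\<^sub>R y'))\<^sup>2 \<le> 2 * (norm (a *\<^sub>R y))\<^sup>2 + 2 * (norm (b *\<^sub>R y'))\<^sup>2"
      using zero_le_power2[of "norm (a *\<^sub>R y - b *\<^sub>R y')"] by linarith
    then show ?thesis by (simp add: power_mult_distrib)
  qed
  have "(LINT x|lebesgue_on \<Omega>. (z x)\<^sup>2)
      \<le> (LINT x|lebesgue_on \<Omega>. 2 * a\<^sup>2 * (v x)\<^sup>2 + 2 * b\<^sup>2 * (w x)\<^sup>2)"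
    using sq[of "v _" "w _"] int(1)[OF z] int(1)[OF v] int(1)[OF w]
    by (intro integral_mono) (auto simp: z_def)
  moreover have "(LINT x|lebesgue_on \<Omega>. (norm (wgrad \<Omega> z x))\<^sup>2)
      \<le> (LINT x|lebesgue_on \<Omega>. 2 * a\<^sup>2 * (norm (wgrad \<Omega> v x))\<^sup>2 + 2 * b\<^sup>2 * (norm (wgrad \<Omega> w x))\<^sup>2)"
  proof (rule integral_mono_AE)
    show "AE x in lebesgue_on \<Omega>. (norm (wgrad \<Omega> z x))\<^sup>2
        \<le> 2 * a\<^sup>2 * (norm (wgrad \<Omega> v x))\<^sup>2 + 2 * b\<^sup>2 * (norm (wgrad \<Omega> w x))\<^sup>2"
      using wgrad_lincomb[OF v w, of a b] unfolding z_def[symmetric]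
      by eventually_elim (simp add: sq)
  qed (use int(2)[OF z] int(2)[OF v] int(2)[OF w] in auto)
  ultimately show ?thesis
    using int[OF v] int[OF w] unfolding z_def[symmetric] H1_norm_sq
    by (simp add: algebra_simps)
qed

lemma zero_in_H10: "(\<lambda>x. 0) \<in> H10 \<Omega>"
proof -
  have 0: "(\<lambda>x. 0) \<in> H1 \<Omega>"
    using zero_in_test_functions test_functions_subset_H1 by blast
  \<comment> \<open>\<open>wgrad\<close> of the zero function is known only as some representative.
    The estimate with both coefficients 0 gives the norm without identifying it.\<close>
  then have "(H1_norm \<Omega> (\<lambda>x. 0))\<^sup>2 \<le> 0"
    using H1_norm_lincomb[OF 0 0, of 0 0] by simp
  then have "H1_norm \<Omega> (\<lambda>x. 0) = 0" by simp
  then show ?thesis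
    using 0 zero_in_test_functions unfolding H10_def by (auto intro!: bexI[of _ "\<lambda>x. 0"])
qed

lemma H10_lincomb:
  assumes v: "v \<in> H10 \<Omega>" and w: "w \<in> H10 \<Omega>"
  shows "(\<lambda>x. a * v x + b * w x) \<in> H10 \<Omega>"
proof -
  note test_H1 = subsetD[OF test_functions_subset_H1]
  have H1: "v \<in> H1 \<Omega>" "w \<in> H1 \<Omega>" using v w by (auto simp: H10_def)
  have "\<exists>\<psi>\<in>test_functions \<Omega>. H1_norm \<Omega> (\<lambda>x. a * v x + b * w x - \<psi> x) < \<epsilon>" if "0 < \<epsilon>" for \<epsilon>
  proof -
    \<comment> \<open>With the tolerance \<open>\<epsilon> / (2 * c)\<close> the squared norm is at
      most \<open>\<epsilon>\<^sup>2 / 2\<close>. The summand 1 keeps \<open>c\<close> positive when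
      both coefficients vanish.\<close>
    define c where "c = 1 + \<bar>a\<bar> + \<bar>b\<bar>"
    have c: "0 < c" by (simp add: c_def)
    then have "0 < \<epsilon> / (2 * c)" using that by simp
    then obtain \<psi> \<eta> where \<psi>: "\<psi> \<in> test_functions \<Omega>" "H1_norm \<Omega> (\<lambda>x. v x - \<psi> x) < \<epsilon> / (2 * c)"
      and \<eta>: "\<eta> \<in> test_functions \<Omega>" "H1_norm \<Omega> (\<lambda>x. w x - \<eta> x) < \<epsilon> / (2 * c)"
      using v w unfolding H10_def by blast
    have diff: "(\<lambda>x. v x - \<psi> x) \<in> H1 \<Omega>" "(\<lambda>x. w x - \<eta> x) \<in> H1 \<Omega>"
      using H1_lincomb[OF H1(1) test_H1[OF \<psi>(1)], of 1 "-1"]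
        H1_lincomb[OF H1(2) test_H1[OF \<eta>(1)], of 1 "-1"] by simp_all
    have nonneg: "0 \<le> H1_norm \<Omega> z" for z by (simp add: H1_norm_def)
    have "(\<lambda>x. a * v x + b * w x - (a * \<psi> x + b * \<eta> x)) = (\<lambda>x. a * (v x - \<psi> x) + b * (w x - \<eta> x))"
      by (simp add: fun_eq_iff algebra_simps)
    then have "(H1_norm \<Omega> (\<lambda>x. a * v x + b * w x - (a * \<psi> x + b * \<eta> x)))\<^sup>2
        \<le> 2 * a\<^sup>2 * (H1_norm \<Omega> (\<lambda>x. v x - \<psi> x))\<^sup>2 + 2 * b\<^sup>2 * (H1_norm \<Omega> (\<lambda>x. w x - \<eta> x))\<^sup>2"
      using H1_norm_lincomb[OF diff, of a b] by simp
    also have "\<dots> \<le> 2 * a\<^sup>2 * (\<epsilon> / (2 * c))\<^sup>2 + 2 * b\<^sup>2 * (\<epsilon> / (2 * c))\<^sup>2"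
      using \<psi>(2) \<eta>(2) nonneg by (intro add_mono mult_left_mono power_mono) (auto intro: less_imp_le)
    also have "\<dots> = 2 * (a\<^sup>2 + b\<^sup>2) * (\<epsilon> / (2 * c))\<^sup>2" by (simp add: algebra_simps)
    also have "\<dots> \<le> 2 * c\<^sup>2 * (\<epsilon> / (2 * c))\<^sup>2"
    proof -
      have "a\<^sup>2 + b\<^sup>2 \<le> (\<bar>a\<bar> + \<bar>b\<bar>)\<^sup>2" by (simp add: power2_sum)
      also have "\<dots> \<le> c\<^sup>2" by (intro power_mono) (auto simp: c_def)
      finally show ?thesis by (intro mult_right_mono) auto
    qed
    also have "\<dots> = \<epsilon>\<^sup>2 / 2" using c by (simp add: power_divide power_mult_distrib)
    also have "\<dots> < \<epsilon>\<^sup>2" using that by simp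
    finally have "H1_norm \<Omega> (\<lambda>x. a * v x + b * w x - (a * \<psi> x + b * \<eta> x)) < \<epsilon>"
      using that by (intro power2_less_imp_less[of _ \<epsilon>]) auto
    then show ?thesis
      by (intro bexI[of _ "\<lambda>x. a * \<psi> x + b * \<eta> x"] test_functions_lincomb \<psi>(1) \<eta>(1))
  qed
  then show ?thesis using H1_lincomb[OF H1] by (simp add: H10_def)
qed

end

section \<open>Finite element functions\<close>

lemma Pk_lincomb: "q \<in> Pk k \<Longrightarrow> r \<in> Pk k \<Longrightarrow> (\<lambda>x. a * q x + b * r x) \<in> Pk k"
proof -
  assume "q \<in> Pk k" "r \<in> Pk k"
  then obtain c d where "q = (\<lambda>x. \<Sum>\<beta> | (\<Sum>i\<in>UNIV. \<beta> i) \<le> k. c \<beta> * monomial_fun \<beta> x)"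
    "r = (\<lambda>x. \<Sum>\<beta> | (\<Sum>i\<in>UNIV. \<beta> i) \<le> k. d \<beta> * monomial_fun \<beta> x)" by (auto simp: Pk_def)
  then show ?thesis unfolding Pk_def mem_Collect_eq
    by (intro exI[of _ "\<lambda>\<beta>. a * c \<beta> + b * d \<beta>"])
      (simp add: sum_distrib_left sum.distrib distrib_right mult.assoc)
qed

lemma Qk_lincomb: "q \<in> Qk k \<Longrightarrow> r \<in> Qk k \<Longrightarrow> (\<lambda>x. a * q x + b * r x) \<in> Qk k"
proof -
  assume "q \<in> Qk k" "r \<in> Qk k"
  then obtain c d where "q = (\<lambda>x. \<Sum>\<beta> | (\<forall>i. \<beta> i \<le> k). c \<beta> * monomial_fun \<beta> x)"
    "r = (\<lambda>x. \<Sum>\<beta> | (\<forall>i. \<beta> i \<le> k). d \<beta> * monomial_fun \<beta> x)" by (auto simp: Qk_def)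
  then show ?thesis unfolding Qk_def mem_Collect_eq
    by (intro exI[of _ "\<lambda>\<beta>. a * c \<beta> + b * d \<beta>"])
      (simp add: sum_distrib_left sum.distrib distrib_right mult.assoc)
qed

lemma zero_in_Pk: "(\<lambda>x. 0) \<in> Pk k"
  unfolding Pk_def by (auto intro!: exI[of _ "\<lambda>_. 0"])

lemma zero_in_Qk: "(\<lambda>x. 0) \<in> Qk k"
  unfolding Qk_def by (auto intro!: exI[of _ "\<lambda>_. 0"])

lemma continuous_on_monomial_fun: "continuous_on S (monomial_fun \<beta>)"
  unfolding monomial_fun_def by (intro continuous_intros)

lemma continuous_on_Pk: "q \<in> Pk k \<Longrightarrow> continuous_on S q"
  unfolding Pk_def by (auto intro!: continuous_intros continuous_on_monomial_fun)

lemma continuous_on_Qk: "q \<in> Qk k \<Longrightarrow> continuous_on S q"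
  unfolding Qk_def by (auto intro!: continuous_intros continuous_on_monomial_fun)

lemma local_space_lincomb:
  "q \<in> local_space k K \<Longrightarrow> r \<in> local_space k K \<Longrightarrow> (\<lambda>x. a * q x + b * r x) \<in> local_space k K"
  using Pk_lincomb[of q k r a b] Qk_lincomb[of "q \<circ> ref_map K" k "r \<circ> ref_map K" a b]
  by (auto simp: local_space_def comp_def split: if_splits)

lemma zero_in_local_space: "(\<lambda>x. 0) \<in> local_space k K"
  by (simp add: local_space_def zero_in_Pk zero_in_Qk comp_def)

text \<open>Elements are compact. On a parallelotope only the pullback
  \<open>q \<circ> ref_map K\<close> is known to be a polynomial, so the bound is taken on the unit
  cube, whose image under \<open>ref_map K\<close> is \<open>K\<close>.\<close>

lemma bounded_local_space:
  fixes K :: "(real^'d) set"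
  assumes K: "int CARD('d) simplex K \<or> is_parallelotope K" and q: "q \<in> local_space k K"
  shows "bounded (q ` K)"
proof (cases "int CARD('d) simplex K")
  case True
  then have "compact K" by (auto simp: simplex compact_convex_hull finite_imp_compact)
  moreover have "continuous_on K q" using q True by (auto simp: local_space_def intro: continuous_on_Pk)
  ultimately show ?thesis by (intro compact_imp_bounded compact_continuous_image)
next
  case False
  then obtain B c where "invertible B" "K = affine_map B c ` cbox 0 1"
    using K by (auto simp: is_parallelotope_def)
  then have "\<exists>F. \<exists>B c. invertible B \<and> F = affine_map B c \<and> K = F ` cbox 0 1" by blast
  from someI_ex[OF this] have "K = ref_map K ` cbox 0 1" unfolding ref_map_def by blast
  then have "q ` K = (q \<circ> ref_map K) ` cbox 0 1" by (metis image_comp)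
  moreover have "continuous_on (cbox 0 1) (q \<circ> ref_map K)"
    using q False by (intro continuous_on_Qk[of _ k]) (simp add: local_space_def)
  ultimately show ?thesis by (simp add: compact_imp_bounded compact_continuous_image)
qed

text \<open>Continuity on the open set gives no bound near the boundary. The bound comes from the
  finitely many closed elements, each with its own local function.\<close>

lemma V_space_bounded:
  assumes P: "is_partition \<Omega> P" and v: "v \<in> V_space \<Omega> P k"
  shows "bounded (v ` \<Omega>)"
proof -
  obtain q where q: "\<And>K. K \<in> P \<Longrightarrow> q K \<in> local_space k K" "\<And>K x. K \<in> P \<Longrightarrow> x \<in> K \<inter> \<Omega> \<Longrightarrow> v x = q K x"
    using v unfolding V_space_def mem_Collect_eq by metis
  have "\<Omega> \<subseteq> \<Union>P" using P closure_subset by (auto simp: is_partition_def)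
  then have "v ` \<Omega> \<subseteq> (\<Union>K\<in>P. q K ` K)" using q(2) by fastforce
  moreover have "bounded (\<Union>K\<in>P. q K ` K)"
    using P q(1) by (intro bounded_UN ballI bounded_local_space[where k = k]) (auto simp: is_partition_def)
  ultimately show ?thesis using bounded_subset by blast
qed

text \<open>Bounded functions on a set of finite measure have integrable powers. The inclusion makes
  discrete functions admissible in the continuous equation.\<close>

lemma V_space_subset_X_space:
  assumes "open \<Omega>" "bounded \<Omega>" "0 \<le> p" and P: "is_partition \<Omega> P"
  shows "V_space \<Omega> P k \<subseteq> X_space \<Omega> p"
proof
  fix v assume v: "v \<in> V_space \<Omega> P k"
  then have H10: "v \<in> H10 \<Omega>" by (simp add: V_space_def)
  then have "v \<in> borel_measurable (lebesgue_on \<Omega>)" by (simp add: H10_def H1_def Lp_space_def)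
  moreover obtain B where "\<And>x. x \<in> \<Omega> \<Longrightarrow> \<bar>v x\<bar> \<le> B"
    using V_space_bounded[OF P v] by (auto simp: bounded_real)
  ultimately have "v \<in> Lp_space \<Omega> p" using assms by (intro bounded_in_Lp_space)
  with H10 show "v \<in> X_space \<Omega> p" by (simp add: X_space_def)
qed

lemma V_space_lincomb:
  assumes "open \<Omega>" "bounded \<Omega>" and v: "v \<in> V_space \<Omega> P k" and w: "w \<in> V_space \<Omega> P k"
  shows "(\<lambda>x. a * v x + b * w x) \<in> V_space \<Omega> P k"
proof -
  have "\<exists>q\<in>local_space k K. \<forall>x\<in>K \<inter> \<Omega>. a * v x + b * w x = q x" if K: "K \<in> P" for K
  proof -
    obtain q r where "q \<in> local_space k K" "\<forall>x\<in>K \<inter> \<Omega>. v x = q x"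
      "r \<in> local_space k K" "\<forall>x\<in>K \<inter> \<Omega>. w x = r x"
      using v w K unfolding V_space_def mem_Collect_eq by metis
    then show ?thesis
      by (intro bexI[of _ "\<lambda>x. a * q x + b * r x"] local_space_lincomb) auto
  qed
  then show ?thesis
    using v w H10_lincomb[OF assms(1,2), of v w a b]
    by (auto simp: V_space_def intro!: continuous_intros)
qed

lemma zero_in_V_space: "open \<Omega> \<Longrightarrow> bounded \<Omega> \<Longrightarrow> (\<lambda>x. 0) \<in> V_space \<Omega> P k"
  by (auto simp: V_space_def zero_in_H10 intro!: bexI[OF _ zero_in_local_space])

lemma V_space_sum:
  assumes "open \<Omega>" "bounded \<Omega>" "\<And>y. y \<in> Y \<Longrightarrow> \<phi> y \<in> V_space \<Omega> P k"
  shows "(\<lambda>x. \<Sum>y\<in>Y. c y * \<phi> y x) \<in> V_space \<Omega> P k"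
  using assms(3)
proof (induction Y rule: infinite_finite_induct)
  case (insert y Y)
  then show ?case
    using V_space_lincomb[OF assms(1,2), of "\<phi> y" P k "\<lambda>x. \<Sum>y\<in>Y. c y * \<phi> y x" "c y" 1] by simp
\<comment> \<open>A sum over an infinite index set is 0 by convention, so this case and the empty
  one both ask for the zero function.\<close>
qed (use zero_in_V_space assms(1,2) in auto)

section \<open>Nodal truncation and the sign of the stabilisation\<close>

lemma pos_part_in_V_space:
  assumes "open \<Omega>" "bounded \<Omega>" "is_lagrange_basis \<Omega> P k \<phi>"
  shows "pos_part \<Omega> P k \<phi> \<aa> v \<in> V_space \<Omega> P k"
  using V_space_sum[of \<Omega> "internal_nodes \<Omega> P k" \<phi> P k "\<lambda>y. max 0 (min (v y) \<aa>)"] assms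
  by (simp add: is_lagrange_basis_def pos_part_def[abs_def])

lemma pos_part_node:
  assumes "finite (internal_nodes \<Omega> P k)" "is_lagrange_basis \<Omega> P k \<phi>" "z \<in> internal_nodes \<Omega> P k"
  shows "pos_part \<Omega> P k \<phi> \<aa> v z = max 0 (min (v z) \<aa>)"
proof -
  have "pos_part \<Omega> P k \<phi> \<aa> v z
      = (\<Sum>y\<in>internal_nodes \<Omega> P k. if z = y then max 0 (min (v y) \<aa>) else 0)"
    unfolding pos_part_def using assms(2,3)
    by (intro sum.cong) (auto simp: is_lagrange_basis_def)
  also have "\<dots> = max 0 (min (v z) \<aa>)" using assms(1,3) by simp
  finally show ?thesis .
qed

text \<open>Only degenerate cases need care: for measurable \<open>f\<close> on a null space the
  essential supremum is minus infinity, which \<open>real_of_ereal\<close> sends to 0, and for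
  non-measurable \<open>f\<close> it is the top element.\<close>

lemma real_of_ereal_esssup_nonneg:
  assumes "\<And>x. 0 \<le> f x" shows "0 \<le> real_of_ereal (esssup M f)"
proof (cases "f \<in> borel_measurable M \<and> emeasure M (space M) = 0")
  case True
  then show ?thesis by (simp add: esssup_zero_space)
next
  case False
  have "0 \<le> esssup M f"
  proof (cases "f \<in> borel_measurable M")
    case True
    then have "esssup M (\<lambda>x. 0) \<le> esssup M f" using assms by (intro esssup_mono) auto
    then show ?thesis using True False by (simp add: esssup_const)
  qed (simp add: esssup_non_measurable top_ereal_def)
  then show ?thesis by (rule real_of_ereal_pos)
qed

lemma Linf_norm_nonneg: "is_matrix_norm N \<Longrightarrow> 0 \<le> Linf_norm \<Omega> N D \<omega>"
  unfolding Linf_norm_def by (intro real_of_ereal_esssup_nonneg) (simp add: is_matrix_norm_def)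

lemma s_form_neg_part_nonpos:
  assumes basis: "is_lagrange_basis \<Omega> P k \<phi>" and "is_matrix_norm N" "0 < \<alpha>" "0 < \<aa>"
    and v: "v \<in> V_plus \<Omega> P k \<aa>"
  shows "s_form \<Omega> D N \<alpha> P k \<hh> (neg_part \<Omega> P k \<phi> \<aa> w) (\<lambda>x. v x - pos_part \<Omega> P k \<phi> \<aa> w x) \<le> 0"
proof (cases "finite (internal_nodes \<Omega> P k)")
  case False
  then show ?thesis by (simp add: s_form_def)
next
  case True
  have "Linf_norm \<Omega> N D (patch P y) * \<hh> y powr (real CARD('a) - 2) * neg_part \<Omega> P k \<phi> \<aa> w y
      * (v y - pos_part \<Omega> P k \<phi> \<aa> w y) \<le> 0" if y: "y \<in> internal_nodes \<Omega> P k" for y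
  proof -
    have vy: "0 \<le> v y" "v y \<le> \<aa>" using v y by (auto simp: V_plus_def)
    \<comment> \<open>Either truncation leaves \<open>w y\<close> unchanged and the first factor is
      0, or \<open>w y\<close> is moved to an endpoint of the interval and \<open>v y\<close> does
      not lie on the side it came from.\<close>
    have "(w y - max 0 (min (w y) \<aa>)) * (v y - max 0 (min (w y) \<aa>)) \<le> 0"
      using vy \<open>0 < \<aa>\<close> by (auto simp: max_def min_def mult_le_0_iff)
    then have "Linf_norm \<Omega> N D (patch P y) * \<hh> y powr (real CARD('a) - 2) *
        ((w y - max 0 (min (w y) \<aa>)) * (v y - max 0 (min (w y) \<aa>))) \<le> 0"
      by (rule mult_nonneg_nonpos[rotated]) (simp add: Linf_norm_nonneg[OF assms(2)])
    then show ?thesis by (simp add: neg_part_def pos_part_node[OF True basis y] mult.assoc)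
  qed
  then show ?thesis
    unfolding s_form_def using \<open>0 < \<alpha>\<close>
    by (intro mult_nonneg_nonpos[OF less_imp_le sum_nonpos])
qed

section \<open>Forms and quasinorms\<close>

context
  fixes \<Omega> :: "(real^'d) set" and D :: "real^'d \<Rightarrow> real^'d^'d"
  assumes open_dom: "open \<Omega>" and bounded_dom: "bounded \<Omega>" and D: "diffusion_tensor \<Omega> D"
begin

text \<open>Entrywise the integrand is a bounded coefficient times a product of two square
  integrable functions. Splitting integrals of differences rests on this.\<close>

lemma a_form_integrable:
  assumes v: "v \<in> H1 \<Omega>" and w: "w \<in> H1 \<Omega>"
  shows "integrable (lebesgue_on \<Omega>) (\<lambda>x. (D x *v wgrad \<Omega> v x) \<bullet> wgrad \<Omega> w x)"
proof -
  obtain M where M: "AE x in lebesgue_on \<Omega>. norm (D x) \<le> M"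
    using D by (auto simp: diffusion_tensor_def)
  have [measurable]: "D \<in> borel_measurable (lebesgue_on \<Omega>)"
    using D by (simp add: diffusion_tensor_def)
  have "integrable (lebesgue_on \<Omega>) (\<lambda>x. D x $ i $ j * wgrad \<Omega> v x $ j * wgrad \<Omega> w x $ i)" for i j
  proof (rule Bochner_Integration.integrable_bound)
    have int: "integrable (lebesgue_on \<Omega>) (\<lambda>x. wgrad \<Omega> v x $ j * wgrad \<Omega> w x $ i)"
      using v w by (intro Lp_space_2_mult_integrable wgrad_Lp[OF open_dom bounded_dom])
    then show "integrable (lebesgue_on \<Omega>) (\<lambda>x. M * (wgrad \<Omega> v x $ j * wgrad \<Omega> w x $ i))" by simp
    have "(\<lambda>A::real^'d^'d. A $ i $ j) \<in> borel_measurable borel"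
      by (intro borel_measurable_continuous_onI continuous_intros)
    then have [measurable]: "(\<lambda>x. D x $ i $ j) \<in> borel_measurable (lebesgue_on \<Omega>)"
      by (rule measurable_compose[rotated]) measurable
    have [measurable]: "(\<lambda>x. wgrad \<Omega> v x $ j) \<in> borel_measurable (lebesgue_on \<Omega>)"
      "(\<lambda>x. wgrad \<Omega> w x $ i) \<in> borel_measurable (lebesgue_on \<Omega>)"
      using wgrad_Lp[OF open_dom bounded_dom v] wgrad_Lp[OF open_dom bounded_dom w]
        Lp_space_measurable by blast+
    show "(\<lambda>x. D x $ i $ j * wgrad \<Omega> v x $ j * wgrad \<Omega> w x $ i) \<in> borel_measurable (lebesgue_on \<Omega>)"
      by measurable
    show "AE x in lebesgue_on \<Omega>. norm (D x $ i $ j * wgrad \<Omega> v x $ j * wgrad \<Omega> w x $ i)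
        \<le> norm (M * (wgrad \<Omega> v x $ j * wgrad \<Omega> w x $ i))"
      using M
    proof eventually_elim
      case (elim x)
      have "\<bar>D x $ i $ j\<bar> \<le> norm (D x $ i)" by (rule component_le_norm_cart)
      also have "\<dots> \<le> norm (D x)" by (rule Finite_Cartesian_Product.norm_nth_le)
      finally have "\<bar>D x $ i $ j\<bar> \<le> \<bar>M\<bar>" using elim by simp
      then show ?case by (auto simp: abs_mult mult.assoc intro!: mult_right_mono)
    qed
  qed
  then show ?thesis
    unfolding inner_vec_def inner_real_def matrix_vector_mult_def vec_lambda_beta sum_distrib_right
    by (intro Bochner_Integration.integrable_sum)
qed

lemma a_form_diff_left:
  assumes v: "v \<in> H1 \<Omega>" and w: "w \<in> H1 \<Omega>" and z: "z \<in> H1 \<Omega>"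
  shows "a_form \<Omega> D (\<lambda>x. v x - w x) z = a_form \<Omega> D v z - a_form \<Omega> D w z"
proof -
  note int = a_form_integrable[OF H1_diff[OF open_dom bounded_dom v w] z] a_form_integrable[OF v z] a_form_integrable[OF w z]
  have "a_form \<Omega> D (\<lambda>x. v x - w x) z
      = (LINT x|lebesgue_on \<Omega>. (D x *v wgrad \<Omega> v x) \<bullet> wgrad \<Omega> z x - (D x *v wgrad \<Omega> w x) \<bullet> wgrad \<Omega> z x)"
    unfolding a_form_def
  proof (rule integral_cong_AE)
    show "AE x in lebesgue_on \<Omega>. (D x *v wgrad \<Omega> (\<lambda>x. v x - w x) x) \<bullet> wgrad \<Omega> z x
        = (D x *v wgrad \<Omega> v x) \<bullet> wgrad \<Omega> z x - (D x *v wgrad \<Omega> w x) \<bullet> wgrad \<Omega> z x"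
      using wgrad_diff[OF open_dom bounded_dom v w]
      by eventually_elim (simp add: matrix_vector_mult_diff_distrib inner_diff_left)
  qed (use int in auto)
  also have "\<dots> = a_form \<Omega> D v z - a_form \<Omega> D w z"
    unfolding a_form_def using int(2,3) by (rule Bochner_Integration.integral_diff)
  finally show ?thesis .
qed

lemma a_form_commute:
  assumes v: "v \<in> H1 \<Omega>" and w: "w \<in> H1 \<Omega>"
  shows "a_form \<Omega> D v w = a_form \<Omega> D w v"
  unfolding a_form_def
proof (rule integral_cong_AE)
  have "AE x in lebesgue_on \<Omega>. transpose (D x) = D x"
    using D by (simp add: diffusion_tensor_def)
  then show "AE x in lebesgue_on \<Omega>. (D x *v wgrad \<Omega> v x) \<bullet> wgrad \<Omega> w x = (D x *v wgrad \<Omega> w x) \<bullet> wgrad \<Omega> v x"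
  proof eventually_elim
    case (elim x)
    then show ?case
      using dot_lmul_matrix[of "wgrad \<Omega> v x" "D x" "wgrad \<Omega> w x"]
        transpose_matrix_vector[of "D x" "wgrad \<Omega> v x"] by (simp add: inner_commute)
  qed
qed (use a_form_integrable[OF v w] a_form_integrable[OF w v] in auto)

lemma a_form_nonneg: "0 \<le> a_form \<Omega> D v v"
  unfolding a_form_def
proof (rule integral_nonneg_AE)
  obtain d0 where "d0 > 0" "AE x in lebesgue_on \<Omega>. \<forall>y. y \<bullet> (D x *v y) \<ge> d0 * (norm y)\<^sup>2"
    using D by (auto simp: diffusion_tensor_def)
  from this(2) show "AE x in lebesgue_on \<Omega>. 0 \<le> (D x *v wgrad \<Omega> v x) \<bullet> wgrad \<Omega> v x"
  proof eventually_elim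
    case (elim x)
    have "0 \<le> d0 * (norm (wgrad \<Omega> v x))\<^sup>2" using \<open>d0 > 0\<close> by simp
    also have "\<dots> \<le> wgrad \<Omega> v x \<bullet> (D x *v wgrad \<Omega> v x)" using elim by blast
    finally show ?case by (simp add: inner_commute)
  qed
qed

text \<open>Expansion of the nonnegative value of the form at \<open>v - w\<close>. It yields the
  factor 1/2 for absorption without Cauchy-Schwarz.\<close>

lemma a_form_young:
  assumes v: "v \<in> H1 \<Omega>" and w: "w \<in> H1 \<Omega>"
  shows "2 * a_form \<Omega> D v w \<le> a_form \<Omega> D v v + a_form \<Omega> D w w"
proof -
  note vw = H1_diff[OF open_dom bounded_dom v w]
  have "a_form \<Omega> D (\<lambda>x. v x - w x) (\<lambda>x. v x - w x)
      = a_form \<Omega> D v (\<lambda>x. v x - w x) - a_form \<Omega> D w (\<lambda>x. v x - w x)"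
    by (rule a_form_diff_left[OF v w vw])
  also have "\<dots> = a_form \<Omega> D v v - a_form \<Omega> D w v - (a_form \<Omega> D v w - a_form \<Omega> D w w)"
    using v w vw by (simp add: a_form_commute[of _ "\<lambda>x. v x - w x"] a_form_diff_left)
  finally show ?thesis
    using a_form_nonneg[of "\<lambda>x. v x - w x"] a_form_commute[OF v w] by simp
qed

end

section \<open>Integrability of the nonlinear terms\<close>

lemma pow_m2_measurable [measurable]: "pow_m2 p \<in> borel_measurable borel"
proof (cases "p = 2")
  case True
  then have "pow_m2 p = (\<lambda>t. 1)" by (simp add: pow_m2_def fun_eq_iff)
  then show ?thesis by simp
next
  case False
  then have "pow_m2 p = (\<lambda>t. t powr (p - 2))" by (simp add: pow_m2_def fun_eq_iff)
  then show ?thesis by simp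
qed

lemma integrable_abs_add_powr:
  assumes "0 \<le> p" "w \<in> Lp_space \<Omega> p" "v \<in> Lp_space \<Omega> p"
  shows "integrable (lebesgue_on \<Omega>) (\<lambda>x. (\<bar>w x\<bar> + \<bar>v x\<bar>) powr p)"
proof -
  have abs: "(\<lambda>x. \<bar>z x\<bar>) \<in> Lp_space \<Omega> p" if "z \<in> Lp_space \<Omega> p" for z :: "real^'a \<Rightarrow> real"
    using that by (auto simp: Lp_space_def)
  show ?thesis
    using Lp_space_lincomb[OF assms(1) abs[OF assms(2)] abs[OF assms(3)], of 1 1]
    by (simp add: Lp_space_def)
qed

lemma quasinorm_integrable:
  assumes p: "2 \<le> p" and w: "w \<in> Lp_space \<Omega> p" and v: "v \<in> Lp_space \<Omega> p"
  shows "integrable (lebesgue_on \<Omega>) (\<lambda>x. (v x)\<^sup>2 * pow_m2 p (\<bar>w x\<bar> + \<bar>v x\<bar>))"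
proof (rule Bochner_Integration.integrable_bound)
  note [measurable] = v[THEN Lp_space_measurable] w[THEN Lp_space_measurable]
  show "integrable (lebesgue_on \<Omega>) (\<lambda>x. (\<bar>w x\<bar> + \<bar>v x\<bar>) powr p)"
    using p w v by (intro integrable_abs_add_powr) auto
  show "(\<lambda>x. (v x)\<^sup>2 * pow_m2 p (\<bar>w x\<bar> + \<bar>v x\<bar>)) \<in> borel_measurable (lebesgue_on \<Omega>)"
    by measurable
  have "(v x)\<^sup>2 * pow_m2 p (\<bar>w x\<bar> + \<bar>v x\<bar>) \<le> (\<bar>w x\<bar> + \<bar>v x\<bar>)\<^sup>2 * pow_m2 p (\<bar>w x\<bar> + \<bar>v x\<bar>)" for x
    by (intro mult_right_mono power2_le_iff_abs_le[THEN iffD2]) auto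
  then show "AE x in lebesgue_on \<Omega>. norm ((v x)\<^sup>2 * pow_m2 p (\<bar>w x\<bar> + \<bar>v x\<bar>)) \<le> norm ((\<bar>w x\<bar> + \<bar>v x\<bar>) powr p)"
    using p by (intro AE_I2) (simp add: power2_mult_pow_m2)
qed

text \<open>Replacing |w| and |v| by their sum turns the integrand into a p-th power, so pointwise
  domination takes the place of Hoelder's inequality.\<close>

lemma b_form_integrable:
  assumes p: "2 \<le> p" and w: "w \<in> Lp_space \<Omega> p" and v: "v \<in> Lp_space \<Omega> p"
  shows "integrable (lebesgue_on \<Omega>) (\<lambda>x. pow_m2 p \<bar>w x\<bar> * w x * v x)"
proof (rule Bochner_Integration.integrable_bound)
  note [measurable] = v[THEN Lp_space_measurable] w[THEN Lp_space_measurable]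
  show "integrable (lebesgue_on \<Omega>) (\<lambda>x. (\<bar>w x\<bar> + \<bar>v x\<bar>) powr p)"
    using p w v by (intro integrable_abs_add_powr) auto
  show "(\<lambda>x. pow_m2 p \<bar>w x\<bar> * w x * v x) \<in> borel_measurable (lebesgue_on \<Omega>)"
    by measurable
  have "pow_m2 p \<bar>w x\<bar> * \<bar>w x\<bar> * \<bar>v x\<bar>
      \<le> pow_m2 p (\<bar>w x\<bar> + \<bar>v x\<bar>) * (\<bar>w x\<bar> + \<bar>v x\<bar>) * (\<bar>w x\<bar> + \<bar>v x\<bar>)" for x
    using p by (intro mult_mono pow_m2_mono) auto
  also have "\<dots> x = (\<bar>w x\<bar> + \<bar>v x\<bar>) powr p" for x
    using power2_mult_pow_m2[OF p, of "\<bar>w x\<bar> + \<bar>v x\<bar>"] by (simp add: power2_eq_square mult_ac)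
  finally show "AE x in lebesgue_on \<Omega>. norm (pow_m2 p \<bar>w x\<bar> * w x * v x) \<le> norm ((\<bar>w x\<bar> + \<bar>v x\<bar>) powr p)"
    by (intro AE_I2) (simp add: abs_mult)
qed

lemma quasinorm_power2:
  "(quasinorm \<Omega> w p v)\<^sup>2 = (LINT x|lebesgue_on \<Omega>. (v x)\<^sup>2 * pow_m2 p (\<bar>w x\<bar> + \<bar>v x\<bar>))"
  by (simp add: quasinorm_def)

section \<open>Quasi-optimality\<close>

text \<open>Isolates what is used of the truncated discrete solution \<open>w\<close>: membership in
  \<open>X_space\<close> and the inequality \<open>le\<close> for one competitor \<open>v\<close>.
  No partition occurs, which makes the constant uniform.\<close>

lemma quasi_optimality_core:
  assumes "open \<Omega>" "bounded \<Omega>" and p: "2 \<le> p" and D: "diffusion_tensor \<Omega> D"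
    and C\<^sub>0: "\<And>a b c. (pow_m2 p \<bar>a\<bar> * a - pow_m2 p \<bar>b\<bar> * b) * (a - c)
      \<le> (pow_m2 p \<bar>a\<bar> * a - pow_m2 p \<bar>b\<bar> * b) * (a - b) / 2
         + C\<^sub>0 * ((a - c)\<^sup>2 * pow_m2 p (\<bar>a\<bar> + \<bar>a - c\<bar>))" "0 < C\<^sub>0"
    and X: "u \<in> X_space \<Omega> p" "w \<in> X_space \<Omega> p" "v \<in> X_space \<Omega> p"
    and le: "a_form \<Omega> D u (\<lambda>x. v x - w x) + b_form \<Omega> p u u (\<lambda>x. v x - w x)
           \<le> a_form \<Omega> D w (\<lambda>x. v x - w x) + b_form \<Omega> p w w (\<lambda>x. v x - w x)"
  shows "(a_norm \<Omega> D (\<lambda>x. u x - w x))\<^sup>2 + (quasinorm \<Omega> u p (\<lambda>x. u x - w x))\<^sup>2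
    \<le> 2 * pow_m2 p 3 * (1 + 2 * C\<^sub>0) *
        ((a_norm \<Omega> D (\<lambda>x. u x - v x))\<^sup>2 + (quasinorm \<Omega> u p (\<lambda>x. u x - v x))\<^sup>2)"
proof -
  have H1: "u \<in> H1 \<Omega>" "w \<in> H1 \<Omega>" "v \<in> H1 \<Omega>" and Lp: "u \<in> Lp_space \<Omega> p" "w \<in> Lp_space \<Omega> p" "v \<in> Lp_space \<Omega> p"
    using X by (auto simp: X_space_def H10_def)
  have Lp_diff: "(\<lambda>x. y x - z x) \<in> Lp_space \<Omega> p" if "y \<in> Lp_space \<Omega> p" "z \<in> Lp_space \<Omega> p" for y z
    using Lp_space_lincomb[OF _ that, of 1 "-1"] p by simp
  note H1_diff = H1_diff[OF assms(1,2)]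
  define e where "e = (\<lambda>x. u x - w x)"
  define g where "g = (\<lambda>x. u x - v x)"
  define F where "F x = pow_m2 p \<bar>u x\<bar> * u x - pow_m2 p \<bar>w x\<bar> * w x" for x
  \<comment> \<open>The test function becomes the difference of the error \<open>e\<close> and the
    approximation error \<open>g\<close>, the two quantities to be compared.\<close>
  have vw: "(\<lambda>x. v x - w x) = (\<lambda>x. e x - g x)" by (simp add: e_def g_def fun_eq_iff)
  have eg: "e \<in> H1 \<Omega>" "g \<in> H1 \<Omega>" unfolding e_def g_def using H1 by (auto intro: H1_diff)
  have eg_Lp: "e \<in> Lp_space \<Omega> p" "g \<in> Lp_space \<Omega> p" unfolding e_def g_def using Lp by (auto intro: Lp_diff)
  let ?a = "a_form \<Omega> D"
  let ?M = "LINT x|lebesgue_on \<Omega>. F x * e x"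
  let ?B = "LINT x|lebesgue_on \<Omega>. F x * g x"
  let ?Q = "\<lambda>z. LINT x|lebesgue_on \<Omega>. (z x)\<^sup>2 * pow_m2 p (\<bar>u x\<bar> + \<bar>z x\<bar>)"
  have F_int: "integrable (lebesgue_on \<Omega>) (\<lambda>x. F x * z x)" if "z \<in> Lp_space \<Omega> p" for z
    using b_form_integrable[OF p Lp(1) that] b_form_integrable[OF p Lp(2) that]
    by (simp add: F_def left_diff_distrib)
  have Q_int: "integrable (lebesgue_on \<Omega>) (\<lambda>x. (z x)\<^sup>2 * pow_m2 p (\<bar>u x\<bar> + \<bar>z x\<bar>))"
    if "z \<in> Lp_space \<Omega> p" for z
    using p Lp(1) that by (rule quasinorm_integrable)

  have "?a u (\<lambda>x. v x - w x) - ?a w (\<lambda>x. v x - w x) = ?a e (\<lambda>x. e x - g x)"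
    using a_form_diff_left[OF assms(1,2) D H1(1,2) H1_diff[OF H1(3,2)]] by (simp add: e_def[symmetric] vw)
  also have "\<dots> = ?a e e - ?a e g"
    using a_form_diff_left[OF assms(1,2) D eg eg(1)] a_form_commute[OF assms(1,2) D] eg H1_diff by simp
  finally have a_eq: "?a u (\<lambda>x. v x - w x) - ?a w (\<lambda>x. v x - w x) = ?a e e - ?a e g" .
  have "b_form \<Omega> p u u (\<lambda>x. v x - w x) - b_form \<Omega> p w w (\<lambda>x. v x - w x)
      = (LINT x|lebesgue_on \<Omega>. F x * (v x - w x))"
    using b_form_integrable[OF p Lp(1) Lp_diff[OF Lp(3,2)]] b_form_integrable[OF p Lp(2) Lp_diff[OF Lp(3,2)]]
    by (simp add: b_form_def F_def left_diff_distrib)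
  also have "\<dots> = (LINT x|lebesgue_on \<Omega>. F x * e x - F x * g x)"
    by (simp add: e_def g_def right_diff_distrib)
  also have "\<dots> = ?M - ?B"
    using F_int[OF eg_Lp(1)] F_int[OF eg_Lp(2)] by (rule Bochner_Integration.integral_diff)
  finally have energy: "?a e e + ?M \<le> ?a e g + ?B" using a_eq le by linarith

  have "?B \<le> (LINT x|lebesgue_on \<Omega>. F x * e x / 2 + C\<^sub>0 * ((g x)\<^sup>2 * pow_m2 p (\<bar>u x\<bar> + \<bar>g x\<bar>)))"
    using F_int eg_Lp Q_int C\<^sub>0(1)[of "u _" "w _" "v _"]
    by (intro integral_mono) (auto simp: F_def e_def g_def)
  also have "\<dots> = ?M / 2 + C\<^sub>0 * ?Q g"
    using F_int[OF eg_Lp(1)] Q_int[OF eg_Lp(2)] by simp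
  finally have B: "?B \<le> ?M / 2 + C\<^sub>0 * ?Q g" .
  have "?Q e \<le> (LINT x|lebesgue_on \<Omega>. 2 * pow_m2 p 3 * (F x * e x))"
    using F_int[OF eg_Lp(1)] Q_int[OF eg_Lp(1)] power_nonlinearity_strongly_monotone[OF p, of "u _" "w _"]
    by (intro integral_mono) (auto simp: F_def e_def)
  then have Q: "?Q e \<le> 2 * pow_m2 p 3 * ?M" by simp
  have Q_nonneg: "0 \<le> ?Q z" for z by (intro integral_nonneg_AE AE_I2) simp
  \<comment> \<open>Lets the energy term share the constant that strong monotonicity attaches to
    \<open>?M\<close>.\<close>
  have three: "1 \<le> pow_m2 p 3" using p by (simp add: pow_m2_def ge_one_powr_ge_zero)
  have a_nonneg: "0 \<le> ?a z z" for z using a_form_nonneg[OF assms(1,2) D] .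
  \<comment> \<open>Young's inequality and the bound \<open>B\<close> return half of
    \<open>?a e e\<close> and half of \<open>?M\<close>. Moving these to the left and doubling gives
    the coefficients 1 and \<open>2 * C\<^sub>0\<close>.\<close>
  have "?a e e + ?M \<le> ?a g g + 2 * C\<^sub>0 * ?Q g"
    using energy B a_form_young[OF assms(1,2) D eg] by linarith
  also have "\<dots> \<le> (1 + 2 * C\<^sub>0) * (?a g g + ?Q g)"
    using C\<^sub>0(2) a_nonneg[of g] Q_nonneg[of g] by (simp add: algebra_simps)
  finally have main: "?a e e + ?M \<le> (1 + 2 * C\<^sub>0) * (?a g g + ?Q g)" .
  have "?a e e + ?Q e \<le> 2 * pow_m2 p 3 * ?a e e + 2 * pow_m2 p 3 * ?M"
    using Q three mult_right_mono[of 1 "2 * pow_m2 p 3" "?a e e"] a_nonneg[of e] by simp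
  also have "\<dots> = 2 * pow_m2 p 3 * (?a e e + ?M)" by (simp add: distrib_left)
  also have "\<dots> \<le> 2 * pow_m2 p 3 * ((1 + 2 * C\<^sub>0) * (?a g g + ?Q g))"
    using main by (intro mult_left_mono) auto
  finally show ?thesis
    using a_nonneg by (simp add: a_norm_def quasinorm_power2 e_def g_def mult.assoc)
qed

theorem theorem4p6:
  fixes \<Omega> :: "(real^'d) set"
    and D :: "real^'d \<Rightarrow> real^'d^'d"
    and N :: "real^'d^'d \<Rightarrow> real"
    and f :: "(real^'d \<Rightarrow> real) \<Rightarrow> real"
    and u :: "real^'d \<Rightarrow> real"
    and p \<alpha> \<aa> \<sigma> :: real
    and k :: nat
  assumes "CARD('d) \<in> {1, 2, 3}"
    and "polyhedral_lipschitz_domain \<Omega>"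
    and "2 \<le> p"
    and "f \<in> Hminus1 \<Omega>"
    and "diffusion_tensor \<Omega> D"
    and "is_matrix_norm N"
    and "1 \<le> k"
    and "0 < \<aa>"
    and "0 < \<alpha>"
    and "u \<in> X_space \<Omega> p"
    and "\<forall>v\<in>X_space \<Omega> p. a_form \<Omega> D u v + b_form \<Omega> p u u v = f v"
  shows "\<exists>C>0. \<forall>P \<phi> \<hh> u\<^sub>h.
     is_partition \<Omega> P \<and> shape_regular \<sigma> P \<and>
     is_lagrange_basis \<Omega> P k \<phi> \<and> is_mesh_function \<Omega> P \<hh> \<and>
     u\<^sub>h \<in> V_space \<Omega> P k \<and>
     (\<forall>v\<in>V_space \<Omega> P k.
        a_form \<Omega> D (pos_part \<Omega> P k \<phi> \<aa> u\<^sub>h) v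
        + b_form \<Omega> p (pos_part \<Omega> P k \<phi> \<aa> u\<^sub>h) (pos_part \<Omega> P k \<phi> \<aa> u\<^sub>h) v
        + s_form \<Omega> D N \<alpha> P k \<hh> (neg_part \<Omega> P k \<phi> \<aa> u\<^sub>h) v = f v) \<longrightarrow>
     (a_norm \<Omega> D (\<lambda>x. u x - pos_part \<Omega> P k \<phi> \<aa> u\<^sub>h x))\<^sup>2
     + (quasinorm \<Omega> u p (\<lambda>x. u x - pos_part \<Omega> P k \<phi> \<aa> u\<^sub>h x))\<^sup>2
     \<le> C * (INF v\<in>V_plus \<Omega> P k \<aa>.
              (a_norm \<Omega> D (\<lambda>x. u x - v x))\<^sup>2 + (quasinorm \<Omega> u p (\<lambda>x. u x - v x))\<^sup>2)"
proof -
  have dom: "open \<Omega>" "bounded \<Omega>" using assms(2) by (auto simp: polyhedral_lipschitz_domain_def)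
  obtain C\<^sub>0 where C\<^sub>0: "0 < C\<^sub>0" "\<And>a b c. (pow_m2 p \<bar>a\<bar> * a - pow_m2 p \<bar>b\<bar> * b) * (a - c)
      \<le> (pow_m2 p \<bar>a\<bar> * a - pow_m2 p \<bar>b\<bar> * b) * (a - b) / 2
         + C\<^sub>0 * ((a - c)\<^sup>2 * pow_m2 p (\<bar>a\<bar> + \<bar>a - c\<bar>))"
    using power_nonlinearity_young[OF assms(3)] by metis
  define C where "C = 2 * pow_m2 p 3 * (1 + 2 * C\<^sub>0)"
  have C: "0 < C" using C\<^sub>0(1) by (simp add: C_def pow_m2_pos)
  show ?thesis
  proof (intro exI[of _ C] conjI allI impI C)
    fix P \<phi> \<hh> u\<^sub>h
    let ?w = "pos_part \<Omega> P k \<phi> \<aa> u\<^sub>h"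
    let ?err = "\<lambda>v. (a_norm \<Omega> D (\<lambda>x. u x - v x))\<^sup>2 + (quasinorm \<Omega> u p (\<lambda>x. u x - v x))\<^sup>2"
    assume "is_partition \<Omega> P \<and> shape_regular \<sigma> P \<and>
      is_lagrange_basis \<Omega> P k \<phi> \<and> is_mesh_function \<Omega> P \<hh> \<and> u\<^sub>h \<in> V_space \<Omega> P k \<and>
      (\<forall>v\<in>V_space \<Omega> P k. a_form \<Omega> D ?w v + b_form \<Omega> p ?w ?w v
         + s_form \<Omega> D N \<alpha> P k \<hh> (neg_part \<Omega> P k \<phi> \<aa> u\<^sub>h) v = f v)"
    then have P: "is_partition \<Omega> P" and \<phi>: "is_lagrange_basis \<Omega> P k \<phi>"
      and discrete: "\<And>v. v \<in> V_space \<Omega> P k \<Longrightarrow> a_form \<Omega> D ?w v + b_form \<Omega> p ?w ?w v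
         + s_form \<Omega> D N \<alpha> P k \<hh> (neg_part \<Omega> P k \<phi> \<aa> u\<^sub>h) v = f v"
      by auto
    have V_X: "V_space \<Omega> P k \<subseteq> X_space \<Omega> p"
      using V_space_subset_X_space[OF dom _ P] assms(3) by simp
    have w: "?w \<in> V_space \<Omega> P k" by (rule pos_part_in_V_space[OF dom \<phi>])
    have "?err ?w \<le> C * ?err v" if v: "v \<in> V_plus \<Omega> P k \<aa>" for v
    proof -
      have vV: "v \<in> V_space \<Omega> P k" using v by (simp add: V_plus_def)
      have vw: "(\<lambda>x. v x - ?w x) \<in> V_space \<Omega> P k"
        using V_space_lincomb[OF dom vV w, of 1 "-1"] by simp
      \<comment> \<open>Both sides are compared with the value of \<open>f\<close> at this function:
        the left one equals it, the right one exceeds it by minus the nonpositive stabilisation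
        term.\<close>
      have "a_form \<Omega> D u (\<lambda>x. v x - ?w x) + b_form \<Omega> p u u (\<lambda>x. v x - ?w x)
          \<le> a_form \<Omega> D ?w (\<lambda>x. v x - ?w x) + b_form \<Omega> p ?w ?w (\<lambda>x. v x - ?w x)"
        using assms(11) V_X vw discrete[OF vw]
          s_form_neg_part_nonpos[OF \<phi> assms(6,9,8) v, of D \<hh> u\<^sub>h] by fastforce
      then show ?thesis
        unfolding C_def using V_X vV w
        by (intro quasi_optimality_core[OF dom assms(3,5) C\<^sub>0(2,1) assms(10)]) auto
    qed
    then have "?err ?w / C \<le> ?err v" if "v \<in> V_plus \<Omega> P k \<aa>" for v
      using that C by (simp add: pos_divide_le_eq mult.commute)
    \<comment> \<open>A lower bound passes to a real infimum only over a nonempty set, hence this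
      admissible element. The division by \<open>C\<close> puts the claim into that form.\<close>
    moreover have "(\<lambda>x. 0) \<in> V_plus \<Omega> P k \<aa>"
      using zero_in_V_space[OF dom] assms(8) by (simp add: V_plus_def)
    ultimately have "?err ?w / C \<le> (INF v\<in>V_plus \<Omega> P k \<aa>. ?err v)"
      by (intro cINF_greatest) auto
    then show "?err ?w \<le> C * (INF v\<in>V_plus \<Omega> P k \<aa>. ?err v)"
      using C by (simp add: pos_divide_le_eq mult.commute)
  qed
qed

end
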